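(* Let $\mathfrak q\in\mathbb C^\times$ with $m=\mathfrak q+\mathfrak q^{-1}\neq0$, let $N\ge1$, $x=\frac12(N\bmod 2)$, and let $j\in x+\mathbb Z$ with $x\le j\le\frac N2$. Then the globalization functor $\mathcal G_N$ maps the standard $\mathsf{TL}_N$-module of weight $j$ to the standard $\mathsf{TL}_{N+2}$-module of weight $j$: $$\mathcal G_N:\ \mathcal W_j[N]\mapsto\mathcal W_j[N+2].$$
   Context: $\mathsf{TL}_N=\mathsf{TL}_N(m)$ is the unital $\mathbb C$-algebra generated by $e_1,\dots,e_{N-1}$ with $e_j^2=me_j$, $e_je_{j\pm1}e_j=e_j$, $e_je_k=e_ke_j$ ($|j-k|>1$), realized by planar non-crossing diagrams with loop weight $m$. The standard module $\mathcal W_j[N]$ has as basis the half-diagrams (link states) on $N$ points with $2j$ through-lines, $\mathsf{TL}_N$ acting by concatenation, loops replaced by $m$, with result zero if the number of through-lines decreases. Let $\mathsf e_{(N)}=\frac1me_{N+1}\in\mathsf{TL}_{N+2}$, an idempotent; $e_j\mapsto\mathsf e_{(N)}e_j\mathsf e_{(N)}$ gives an isomorphism $\mathsf{TL}_N\cong\mathsf e_{(N)}\mathsf{TL}_{N+2}\mathsf e_{(N)}$. The globalization functor sends a finite-dimensional $\mathsf{TL}_N$-module $M$ to the $\mathsf{TL}_{N+2}$-module $\mathcal G_N(M)=\mathsf{TL}_{N+2}\mathsf e_{(N)}\otimes_{\mathsf{TL}_N}M$, where $\mathsf{TL}_{N+2}\mathsf e_{(N)}$ is a right $\mathsf{TL}_N$-module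 via this isomorphism. The statement means $\mathcal G_N(\mathcal W_j[N])\cong\mathcal W_j[N+2]$. *)

theory Defs
  imports Complex_Main "HOL-Combinatorics.Permutations"
    "HOL-Algebra.Module" "HOL-Algebra.QuotRing" "HOL-Algebra.Free_Abelian_Groups"
begin

section \<open>Left modules and tensor products over arbitrary rings\<close>

text \<open>
  The locale \<open>module\<close> of HOL-Algebra is restricted to commutative rings, so unital left modules over
  an arbitrary ring are introduced here.  As for \<open>module\<close>, the multiplicative fields of the record
  carrying the module are irrelevant.
\<close>

locale left_module = R?: ring R + M?: abelian_group M
  for R :: "('a, 'r) ring_scheme" (structure) and M :: "('a, 'b, 'c) module_scheme" (structure) +
  assumes smult_closed: "\<lbrakk>a \<in> carrier R; v \<in> carrier M\<rbrakk> \<Longrightarrow> a \<odot>\<^bsub>M\<^esub> v \<in> carrier M"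
    and smult_l_distr: "\<lbrakk>a \<in> carrier R; b \<in> carrier R; v \<in> carrier M\<rbrakk> \<Longrightarrow>
      (a \<oplus> b) \<odot>\<^bsub>M\<^esub> v = a \<odot>\<^bsub>M\<^esub> v \<oplus>\<^bsub>M\<^esub> b \<odot>\<^bsub>M\<^esub> v"
    and smult_r_distr: "\<lbrakk>a \<in> carrier R; v \<in> carrier M; w \<in> carrier M\<rbrakk> \<Longrightarrow>
      a \<odot>\<^bsub>M\<^esub> (v \<oplus>\<^bsub>M\<^esub> w) = a \<odot>\<^bsub>M\<^esub> v \<oplus>\<^bsub>M\<^esub> a \<odot>\<^bsub>M\<^esub> w"
    and smult_assoc: "\<lbrakk>a \<in> carrier R; b \<in> carrier R; v \<in> carrier M\<rbrakk> \<Longrightarrow>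
      (a \<otimes> b) \<odot>\<^bsub>M\<^esub> v = a \<odot>\<^bsub>M\<^esub> (b \<odot>\<^bsub>M\<^esub> v)"
    and smult_one: "v \<in> carrier M \<Longrightarrow> \<one> \<odot>\<^bsub>M\<^esub> v = v"

definition left_module_iso ::
  "('a, 'r) ring_scheme \<Rightarrow> ('a, 'b, 'c) module_scheme \<Rightarrow> ('a, 'd, 'e) module_scheme \<Rightarrow> bool" where
  "left_module_iso R M M' \<longleftrightarrow> left_module R M \<and> left_module R M' \<and>
     (\<exists>f. bij_betw f (carrier M) (carrier M') \<and>
        (\<forall>v\<in>carrier M. \<forall>w\<in>carrier M. f (v \<oplus>\<^bsub>M\<^esub> w) = f v \<oplus>\<^bsub>M'\<^esub> f w) \<and>
        (\<forall>a\<in>carrier R. \<forall>v\<in>carrier M. f (a \<odot>\<^bsub>M\<^esub> v) = a \<odot>\<^bsub>M'\<^esub> f v))"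

text \<open>
  The tensor product of a right \<open>R\<close>-module \<open>P\<close>, with right action \<open>ract\<close>, and a left \<open>R\<close>-module \<open>M\<close>
  is the free abelian group on pairs modulo the biadditive, \<open>R\<close>-balanced relations.  If \<open>P\<close> is a
  bimodule, its left action is inherited by the tensor product.
\<close>

definition tensor_relations ::
  "('a, 'r) ring_scheme \<Rightarrow> ('s, 'p, 'c) module_scheme \<Rightarrow> ('p \<Rightarrow> 'a \<Rightarrow> 'p) \<Rightarrow> ('a, 'b, 'd) module_scheme \<Rightarrow>
    (('p \<times> 'b) \<Rightarrow>\<^sub>0 int) set" where
  "tensor_relations R P ract M =
     {frag_of (x \<oplus>\<^bsub>P\<^esub> y, v) - frag_of (x, v) - frag_of (y, v) | x y v.
        x \<in> carrier P \<and> y \<in> carrier P \<and> v \<in> carrier M} \<union>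
     {frag_of (x, v \<oplus>\<^bsub>M\<^esub> w) - frag_of (x, v) - frag_of (x, w) | x v w.
        x \<in> carrier P \<and> v \<in> carrier M \<and> w \<in> carrier M} \<union>
     {frag_of (ract x r, v) - frag_of (x, r \<odot>\<^bsub>M\<^esub> v) | x r v.
        x \<in> carrier P \<and> r \<in> carrier R \<and> v \<in> carrier M}"

definition tensor_product ::
  "('a, 'r) ring_scheme \<Rightarrow> ('s, 'p, 'c) module_scheme \<Rightarrow> ('p \<Rightarrow> 'a \<Rightarrow> 'p) \<Rightarrow> ('a, 'b, 'd) module_scheme \<Rightarrow>
    ('s, (('p \<times> 'b) \<Rightarrow>\<^sub>0 int) set) module" where
  "tensor_product R P ract M =
     (let F = free_Abelian_group (carrier P \<times> carrier M);
          K = generate F (tensor_relations R P ract M)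
      in \<lparr>carrier = carrier (F Mod K), monoid.mult = undefined, one = undefined,
          ring.zero = \<one>\<^bsub>F Mod K\<^esub>, ring.add = (\<otimes>\<^bsub>F Mod K\<^esub>),
          smult = (\<lambda>a X. the_elem
            ((\<lambda>c. K #>\<^bsub>F\<^esub> frag_extend (\<lambda>(x, v). frag_of (a \<odot>\<^bsub>P\<^esub> x, v)) c) ` X))\<rparr>)"


section \<open>The Temperley--Lieb algebra\<close>

text \<open>
  Words form a monoid under concatenation, written additively so that the convolution product
  makes \<open>word \<Rightarrow>\<^sub>0 complex\<close> the free unital complex algebra on countably many generators.
\<close>

datatype word = Word (letters: "nat list")

instantiation word :: monoid_add
begin

definition zero_word :: word where "0 = Word []"

definition plus_word :: "word \<Rightarrow> word \<Rightarrow> word" where "v + w = Word (letters v @ letters w)"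

instance
  by standard (simp_all add: zero_word_def plus_word_def)

end

type_synonym free_alg = "word \<Rightarrow>\<^sub>0 complex"

definition gen :: "nat \<Rightarrow> free_alg" where
  "gen i = Poly_Mapping.single (Word [i]) 1"

definition scalar :: "complex \<Rightarrow> free_alg" where
  "scalar c = Poly_Mapping.single 0 c"

definition free_algebra :: "nat \<Rightarrow> free_alg ring" where
  "free_algebra N = \<lparr>carrier = {f. \<forall>w\<in>Poly_Mapping.keys f. set (letters w) \<subseteq> {1..<N}},
     monoid.mult = (*), one = 1, ring.zero = 0, ring.add = (+)\<rparr>"

definition tl_relations :: "nat \<Rightarrow> complex \<Rightarrow> free_alg set" where
  "tl_relations N m =
     {gen i * gen i - scalar m * gen i | i. i \<in> {1..<N}} \<union>
     {gen i * gen k * gen i - gen i | i k.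
        i \<in> {1..<N} \<and> k \<in> {1..<N} \<and> (k = i + 1 \<or> i = k + 1)} \<union>
     {gen i * gen k - gen k * gen i | i k.
        i \<in> {1..<N} \<and> k \<in> {1..<N} \<and> (i + 1 < k \<or> k + 1 < i)}"

definition tl_ideal :: "nat \<Rightarrow> complex \<Rightarrow> free_alg set" where
  "tl_ideal N m = Idl\<^bsub>free_algebra N\<^esub> (tl_relations N m)"

definition TL :: "nat \<Rightarrow> complex \<Rightarrow> free_alg set ring" where
  "TL N m = free_algebra N Quot tl_ideal N m"

definition tl_class :: "nat \<Rightarrow> complex \<Rightarrow> free_alg \<Rightarrow> free_alg set" where
  "tl_class N m f = tl_ideal N m +>\<^bsub>free_algebra N\<^esub> f"

text \<open>
  \<open>extend_action g f v\<close> applies to \<open>v\<close> the operator obtained from \<open>f\<close> by substituting the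
  operators \<open>g i\<close> for the generators.
\<close>

definition scale :: "complex \<Rightarrow> ('k \<Rightarrow>\<^sub>0 complex) \<Rightarrow> 'k \<Rightarrow>\<^sub>0 complex" where
  "scale c v = Poly_Mapping.map ((*) c) v"

definition extend_action ::
  "(nat \<Rightarrow> ('k \<Rightarrow>\<^sub>0 complex) \<Rightarrow> 'k \<Rightarrow>\<^sub>0 complex) \<Rightarrow> free_alg \<Rightarrow> ('k \<Rightarrow>\<^sub>0 complex) \<Rightarrow> 'k \<Rightarrow>\<^sub>0 complex" where
  "extend_action g f v =
     (\<Sum>w\<in>Poly_Mapping.keys f. scale (Poly_Mapping.lookup f w) (foldr g (letters w) v))"


section \<open>Standard modules\<close>

text \<open>
  A link state on the points \<open>1, \<dots>, N\<close> is encoded by the involution exchanging the two ends of each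
  arc and fixing the ends of the through-lines.  The last condition says that whatever starts
  strictly below an arc is an arc that stays there: arcs do not cross each other, and no
  through-line is enclosed by an arc.
\<close>

type_synonym link = "nat \<Rightarrow> nat"

definition link_state :: "nat \<Rightarrow> link \<Rightarrow> bool" where
  "link_state N p \<longleftrightarrow> p permutes {1..N} \<and> (\<forall>a. p (p a) = a) \<and>
     (\<forall>a b. a < b \<and> b < p a \<longrightarrow> p b \<noteq> b \<and> a < p b \<and> p b < p a)"

definition through_lines :: "nat \<Rightarrow> link \<Rightarrow> nat set" where
  "through_lines N p = {k \<in> {1..N}. p k = k}"

definition link_states :: "nat \<Rightarrow> real \<Rightarrow> link set" where
  "link_states N j = {p. link_state N p \<and> real (card (through_lines N p)) = 2 * j}"

text \<open>
  Concatenating the diagram of \<open>e\<^sub>i\<close> with \<open>p\<close> closes the points \<open>i\<close> and \<open>i + 1\<close> of \<open>p\<close> by an arc and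
  adds a new arc joining \<open>i\<close> and \<open>i + 1\<close>.  In \<open>reconnect i p\<close> the former partners of \<open>i\<close> and \<open>i + 1\<close>
  become connected to each other; if one of \<open>i\<close>, \<open>i + 1\<close> carried a through-line, the partner of the
  other inherits it.  In \<open>link_action\<close>, a loop is closed in the first case, and two through-lines
  are joined, so that their number decreases, in the second.
\<close>

definition reconnect :: "nat \<Rightarrow> link \<Rightarrow> link" where
  "reconnect i p = (\<lambda>k.
     if k = i then i + 1
     else if k = i + 1 then i
     else if k = p i then (if p (i + 1) = i + 1 then k else p (i + 1))
     else if k = p (i + 1) then (if p i = i then k else p i)
     else p k)"

definition link_action :: "complex \<Rightarrow> nat \<Rightarrow> link \<Rightarrow> link \<Rightarrow>\<^sub>0 complex" where
  "link_action m i p =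
     (if p i = i + 1 then Poly_Mapping.single p m
      else if p i = i \<and> p (i + 1) = i + 1 then 0
      else Poly_Mapping.single (reconnect i p) 1)"

definition gen_action :: "complex \<Rightarrow> nat \<Rightarrow> (link \<Rightarrow>\<^sub>0 complex) \<Rightarrow> link \<Rightarrow>\<^sub>0 complex" where
  "gen_action m i v = (\<Sum>p\<in>Poly_Mapping.keys v. scale (Poly_Mapping.lookup v p) (link_action m i p))"

definition standard_module :: "nat \<Rightarrow> complex \<Rightarrow> real \<Rightarrow> (free_alg set, link \<Rightarrow>\<^sub>0 complex) module" where
  "standard_module N m j =
     \<lparr>carrier = {v. Poly_Mapping.keys v \<subseteq> link_states N j},
      monoid.mult = undefined, one = undefined, ring.zero = 0, ring.add = (+),
      smult = (\<lambda>a v. the_elem ((\<lambda>f. extend_action (gen_action m) f v) ` a))\<rparr>"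


section \<open>Globalization\<close>

definition idem :: "nat \<Rightarrow> complex \<Rightarrow> free_alg" where
  "idem N m = scalar (1 / m) * gen (N + 1)"

text \<open>
  The algebra homomorphism from \<open>TL N m\<close> to \<open>TL (N + 2) m\<close> sending the generator \<open>e\<^sub>i\<close> to the class
  of \<open>idem * e\<^sub>i * idem\<close> and the unit to the class of \<open>idem\<close>, the unit of the corner algebra.
\<close>

definition corner_map :: "nat \<Rightarrow> complex \<Rightarrow> free_alg set \<Rightarrow> free_alg set" where
  "corner_map N m a = the_elem ((\<lambda>f. tl_class (N + 2) m
     (extend_action (\<lambda>i h. idem N m * gen i * idem N m * h) f (idem N m))) ` a)"

definition corner_module :: "nat \<Rightarrow> complex \<Rightarrow> (free_alg set, free_alg set) module" where
  "corner_module N m =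
     \<lparr>carrier = {a \<otimes>\<^bsub>TL (N + 2) m\<^esub> tl_class (N + 2) m (idem N m) | a. a \<in> carrier (TL (N + 2) m)},
      monoid.mult = undefined, one = undefined,
      ring.zero = \<zero>\<^bsub>TL (N + 2) m\<^esub>, ring.add = (\<oplus>\<^bsub>TL (N + 2) m\<^esub>),
      smult = (\<otimes>\<^bsub>TL (N + 2) m\<^esub>)\<rparr>"

definition globalization ::
  "nat \<Rightarrow> complex \<Rightarrow> (free_alg set, 'b, 'c) module_scheme \<Rightarrow>
    (free_alg set, ((free_alg set \<times> 'b) \<Rightarrow>\<^sub>0 int) set) module" where
  "globalization N m M =
     tensor_product (TL N m) (corner_module N m)
       (\<lambda>x a. x \<otimes>\<^bsub>TL (N + 2) m\<^esub> corner_map N m a) M"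

end

theory Submission
  imports Defs
begin

text \<open>
  Globalization sends \<open>M\<close> to the module over the larger algebra that is universal for linear maps \<open>\<theta>\<close>
  from \<open>M\<close> into the part \<open>e X\<close> of a module \<open>X\<close>, where \<open>e = e\<^bsub>N+1\<^esub> / m\<close>, that commute with the smaller
  algebra. The proof shows that the standard module on \<open>N + 2\<close> points has this property for the standard
  module on \<open>N\<close> points, with respect to the map that adds an arc joining the two new points.

  Let \<open>c\<^sub>k\<close> denote the insertion of an arc joining the points \<open>k\<close> and \<open>k + 1\<close> into a link state
  (\<open>insert_arc\<close>). Everything rests on four rules: \<open>e\<^sub>k c\<^sub>k = m c\<^sub>k\<close>, \<open>e\<^bsub>k+1\<^esub> c\<^sub>k = c\<^bsub>k+1\<^esub>\<close>,
  \<open>e\<^sub>k c\<^bsub>k+1\<^esub> = c\<^sub>k\<close>, and \<open>e\<^sub>i c\<^sub>k = c\<^sub>k e\<^bsub>i'\<^esub>\<close> for the other \<open>i\<close>, where \<open>i' = i\<close> below the arc and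
  \<open>i' = i - 2\<close> above it. Since a link state with at least one arc has an arc between neighbouring points
  (\<open>link_state_small_arc\<close>), these rules determine the action, and induction over the removal of such an arc
  also proves that link states carry an action of the algebra given by generators and relations
  (\<open>left_module_standard_module\<close>).

  Let \<open>\<theta>\<close> be a linear map from the small standard module to a module over the large algebra such that
  \<open>e\<^sub>i \<theta> w = \<theta> (e\<^sub>i w)\<close> for \<open>i < N\<close> and \<open>e\<^bsub>N+1\<^esub> \<theta> w = m \<theta> w\<close>. An extension \<open>\<Phi>\<close> with
  \<open>\<Phi> (c\<^bsub>N+1\<^esub> w) = \<theta> w\<close> must satisfy \<open>\<Phi> (c\<^sub>k w) = e\<^sub>k \<dots> e\<^sub>N \<theta> w\<close>. The relations of the algebra show that the
  right-hand sides obey the same four rules as the \<open>c\<^sub>k w\<close>, so \<open>\<Phi>\<close> is linear over the algebra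
  (\<open>\<Phi>_linear\<close>) provided that it is well defined. Well-definedness concerns link states with several small
  arcs. It follows by moving one of two arcs until it is next to the other, where the two candidate values
  agree up to a factor \<open>m \<noteq> 0\<close> (\<open>\<phi>_two_arcs\<close>).

  Taking \<open>\<theta> w = e \<otimes> w\<close> gives \<open>\<Phi>\<close> from the large standard module to the globalization, and
  \<open>x \<otimes> w \<mapsto> x \<cdot> c\<^bsub>N+1\<^esub> w\<close> gives a map in the other direction. They are mutually inverse because they are so
  on the generating elements \<open>e \<otimes> w\<close> and \<open>c\<^bsub>N+1\<^esub> w\<close> (\<open>globalization_iso\<close>).
\<close>

section \<open>Inserting and deleting small arcs\<close>

text \<open>
  Removing an arc between the neighbouring points \<open>k\<close> and \<open>k + 1\<close> relabels the points above it by
  \<open>unskip k\<close>; inserting one relabels them by the order embedding \<open>skip k\<close>, which misses exactly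
  \<open>k\<close> and \<open>k + 1\<close>.
\<close>

definition skip :: "nat \<Rightarrow> nat \<Rightarrow> nat" where
  "skip k a = (if a < k then a else a + 2)"

definition unskip :: "nat \<Rightarrow> nat \<Rightarrow> nat" where
  "unskip k a = (if a < k then a else a - 2)"

definition insert_arc :: "nat \<Rightarrow> link \<Rightarrow> link" where
  "insert_arc k p = (\<lambda>a. if a = k then k + 1 else if a = k + 1 then k else skip k (p (unskip k a)))"

definition delete_arc :: "nat \<Rightarrow> link \<Rightarrow> link" where
  "delete_arc k p = (\<lambda>a. unskip k (p (skip k a)))"

lemma unskip_skip [simp]: "unskip k (skip k a) = a"
  by (simp add: skip_def unskip_def)

lemma skip_unskip: "a \<noteq> k \<Longrightarrow> a \<noteq> k + 1 \<Longrightarrow> skip k (unskip k a) = a"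
  by (auto simp: skip_def unskip_def)

lemma skip_cases:
  obtains "a = k" | "a = k + 1" | b where "a = skip k b"
  by (metis skip_unskip)

lemma skip_neq [simp]: "skip k a \<noteq> k" "skip k a \<noteq> Suc k" "k \<noteq> skip k a" "Suc k \<noteq> skip k a"
  by (auto simp: skip_def)

lemma skip_less_iff [simp]: "skip k a < skip k b \<longleftrightarrow> a < b"
  by (auto simp: skip_def)

lemma skip_eq_iff [simp]: "skip k a = skip k b \<longleftrightarrow> a = b"
  by (auto simp: skip_def)

lemma insert_arc_simps [simp]:
  "insert_arc k p k = k + 1" "insert_arc k p (Suc k) = k" "insert_arc k p (skip k a) = skip k (p a)"
  by (simp_all add: insert_arc_def)

lemma delete_insert_arc [simp]: "delete_arc k (insert_arc k p) = p"
  by (simp add: delete_arc_def)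

lemma link_eqI_skip:
  assumes "P k = Q k" "P (k + 1) = Q (k + 1)" "\<And>a. P (skip k a) = Q (skip k a)"
  shows "P = Q"
proof
  fix a show "P a = Q a"
    by (rule skip_cases[of a k]) (use assms in auto)
qed

text \<open>
  An involution is a bijection, so being a permutation of \<open>{1..N}\<close> reduces to fixing all other points.
\<close>

lemma link_state_iff:
  "link_state N p \<longleftrightarrow> (\<forall>a. p (p a) = a) \<and> (\<forall>a. a \<notin> {1..N} \<longrightarrow> p a = a) \<and>
     (\<forall>a b. a < b \<and> b < p a \<longrightarrow> p b \<noteq> b \<and> a < p b \<and> p b < p a)"
proof -
  have "\<exists>!x. p x = y" if "\<forall>a. p (p a) = a" for y
    using that by metis
  then show ?thesis unfolding link_state_def permutes_def by blast
qed

lemma link_state_insert_arc: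
  assumes p: "link_state N p" and k: "1 \<le> k" "k \<le> N + 1"
  shows "link_state (N + 2) (insert_arc k p)"
proof -
  have inv: "p (p a) = a" for a using p by (simp add: link_state_iff)
  have out: "p a = a" if "a \<notin> {1..N}" for a using p that by (simp add: link_state_iff)
  have planar: "p b \<noteq> b \<and> a < p b \<and> p b < p a" if "a < b" "b < p a" for a b
    using p that by (simp add: link_state_iff)
  let ?P = "insert_arc k p"
  have "?P (?P a) = a" for a
    by (rule skip_cases[of a k]) (auto simp: inv)
  moreover have "?P a = a" if "a \<notin> {1..N+2}" for a
  proof (rule skip_cases[of a k])
    fix b assume b: "a = skip k b"
    then have "b \<notin> {1..N}" using that k by (auto simp: skip_def split: if_splits)
    then show ?thesis by (simp add: b out)
  qed (use that k in auto)
  moreover have "?P b \<noteq> b \<and> a < ?P b \<and> ?P b < ?P a" if ab: "a < b" "b < ?P a" for a b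
  proof (rule skip_cases[of a k])
    fix a' assume a: "a = skip k a'"
    show ?thesis
    proof (rule skip_cases[of b k])
      fix b' assume b: "b = skip k b'"
      show ?thesis using ab planar[of a' b'] by (auto simp: a b)
    next
      assume b: "b = k"
      have "?P a = skip k (p a')" "a \<noteq> k" "a \<noteq> k + 1" by (simp_all add: a)
      moreover have "skip k (p a') \<noteq> k" "skip k (p a') \<noteq> k + 1" by simp_all
      ultimately have "a < k" "k + 1 < ?P a" using ab b by linarith+
      then show ?thesis by (simp add: b)
    next
      assume b: "b = k + 1"
      have "?P a = skip k (p a')" "a \<noteq> k" "a \<noteq> k + 1" by (simp_all add: a)
      moreover have "skip k (p a') \<noteq> k" "skip k (p a') \<noteq> k + 1" by simp_all
      ultimately have "a < k" "k + 1 < ?P a" using ab b by linarith+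
      then show ?thesis by (simp add: b)
    qed
  qed (use ab in auto)
  ultimately show ?thesis unfolding link_state_iff by blast
qed

lemma through_lines_insert_arc:
  assumes k: "1 \<le> k" "k \<le> N + 1"
  shows "through_lines (N + 2) (insert_arc k p) = skip k ` through_lines N p"
proof -
  have "a \<in> through_lines (N + 2) (insert_arc k p) \<longleftrightarrow> a \<in> skip k ` through_lines N p" for a
  proof (rule skip_cases[of a k])
    fix b assume b: "a = skip k b"
    have "skip k b \<in> {1..N+2} \<longleftrightarrow> b \<in> {1..N}"
      using k by (auto simp: skip_def)
    then show ?thesis by (auto simp: b through_lines_def)
  qed (auto simp: through_lines_def)
  then show ?thesis by blast
qed

lemma insert_arc_in_link_states:
  assumes "p \<in> link_states N j" "1 \<le> k" "k \<le> N + 1"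
  shows "insert_arc k p \<in> link_states (N + 2) j"
proof -
  have "inj_on (skip k) A" for A by (auto simp: inj_on_def)
  then show ?thesis
    using assms link_state_insert_arc[of N p k] through_lines_insert_arc[of k N p]
    by (auto simp: link_states_def card_image)
qed

text \<open>
  The involution matches \<open>k\<close> with \<open>k + 1\<close>, so no other point is sent there and relabelling loses
  nothing.
\<close>

lemma insert_delete_arc:
  assumes inv: "\<And>a. P (P a) = a" and k: "P k = k + 1"
  shows "insert_arc k (delete_arc k P) = P"
proof (rule link_eqI_skip[where k = k])
  have k': "P (Suc k) = k" using inv[of k] k by simp
  show "insert_arc k (delete_arc k P) (k + 1) = P (k + 1)" using k' by simp
  fix a
  have "P (skip k a) \<noteq> k" "P (skip k a) \<noteq> k + 1"
    using inv[of "skip k a"] k k' by auto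
  then show "insert_arc k (delete_arc k P) (skip k a) = P (skip k a)"
    by (simp add: delete_arc_def skip_unskip)
qed (use k in simp)

lemma link_state_delete_arc:
  assumes P: "link_state (N + 2) P" and k: "P k = k + 1"
  shows "link_state N (delete_arc k P)" "1 \<le> k" "k \<le> N + 1"
proof -
  have inv: "P (P a) = a" for a using P by (simp add: link_state_iff)
  have out: "P a = a" if "a \<notin> {1..N+2}" for a using P that by (simp add: link_state_iff)
  have planar: "P b \<noteq> b \<and> a < P b \<and> P b < P a" if "a < b" "b < P a" for a b
    using P that by (simp add: link_state_iff)
  have k': "P (k + 1) = k" using inv[of k] k by simp
  show k1: "1 \<le> k" using out[of k] k by (cases "k = 0") auto
  show k2: "k \<le> N + 1" using out[of "k+1"] k' by (cases "k \<le> N + 1") auto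
  define p where "p = delete_arc k P"
  have Pp: "P (skip k a) = skip k (p a)" for a
    using insert_delete_arc[of P k] inv k by (metis insert_arc_simps(3) p_def)
  have "p (p a) = a" for a using inv[of "skip k a"] by (simp add: Pp)
  moreover have "p a = a" if "a \<notin> {1..N}" for a
  proof -
    have "skip k a \<notin> {1..N+2}" using that k1 k2 by (auto simp: skip_def)
    then show ?thesis using out[of "skip k a"] by (simp add: Pp)
  qed
  moreover have "p b \<noteq> b \<and> a < p b \<and> p b < p a" if "a < b" "b < p a" for a b
    using planar[of "skip k a" "skip k b"] that by (simp add: Pp)
  ultimately show "link_state N (delete_arc k P)"
    unfolding link_state_iff p_def by blast
qed

lemma delete_arc_in_link_states:
  assumes P: "P \<in> link_states (N + 2) j" and k: "P k = k + 1"
  shows "delete_arc k P \<in> link_states N j" "1 \<le> k" "k \<le> N + 1" "insert_arc k (delete_arc k P) = P"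
proof -
  have ls: "link_state (N + 2) P" using P by (simp add: link_states_def)
  show ins: "insert_arc k (delete_arc k P) = P"
    using ls k by (intro insert_delete_arc) (auto simp: link_state_iff)
  show k': "1 \<le> k" "k \<le> N + 1" using link_state_delete_arc[OF ls k] by auto
  have "inj_on (skip k) A" for A by (auto simp: inj_on_def)
  then have "card (through_lines (N + 2) P) = card (through_lines N (delete_arc k P))"
    using through_lines_insert_arc[OF k', of "delete_arc k P"] by (simp add: ins card_image)
  then show "delete_arc k P \<in> link_states N j"
    using P link_state_delete_arc(1)[OF ls k] by (simp add: link_states_def)
qed

text \<open>A shortest arc joins neighbouring points, since whatever lies below an arc is a shorter arc.\<close>

lemma link_state_small_arc:
  assumes P: "link_state N P" and "P \<noteq> id"
  obtains k where "P k = k + 1"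
proof -
  have inv: "P (P a) = a" for a using P by (simp add: link_state_iff)
  have planar: "P b \<noteq> b \<and> a < P b \<and> P b < P a" if "a < b" "b < P a" for a b
    using P that by (simp add: link_state_iff)
  obtain a where "P a \<noteq> a" using \<open>P \<noteq> id\<close> by (auto simp: fun_eq_iff)
  then have "a < P a \<or> P a < P (P a)" by (auto simp: inv)
  then obtain a' where "a' < P a'" by blast
  then obtain k where k: "k < P k" and least: "\<And>b. b < P b \<Longrightarrow> P k - k \<le> P b - b"
    using ex_has_least_nat[of "\<lambda>a. a < P a" a' "\<lambda>a. P a - a"] by blast
  have "P k = k + 1"
  proof (rule ccontr)
    assume "P k \<noteq> k + 1"
    then have lt: "k + 1 < P k" using k by simp
    then have "P (k+1) \<noteq> k + 1" "k < P (k+1)" "P (k+1) < P k" using planar[of k "k+1"] by auto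
    then show False using least[of "k+1"] lt by force
  qed
  then show thesis by (rule that)
qed

text \<open>
  This turns claims about link states into inductions on the number of points.
\<close>

lemma link_state_cases:
  assumes P: "link_state N P"
  obtains "P = id" | M k p where "N = M + 2" "1 \<le> k" "k \<le> M + 1" "link_state M p" "P = insert_arc k p"
proof (cases "P = id")
  case False
  then obtain k where k: "P k = k + 1" using P link_state_small_arc by blast
  have "P (k + 1) = k" using P k by (metis link_state_iff)
  have "k \<noteq> 0" using P k unfolding link_state_iff by (cases "k = 0") auto
  moreover have "k + 1 \<le> N" using P \<open>P (k+1) = k\<close> unfolding link_state_iff
    by (metis atLeastAtMost_iff n_not_Suc_n Suc_eq_plus1)
  ultimately obtain M where M: "N = M + 2" by (metis Suc_eq_plus1 add_2_eq_Suc' le_Suc_ex not0_implies_Suc plus_nat.simps(2) add.commute)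
  have "insert_arc k (delete_arc k P) = P"
    using P k by (intro insert_delete_arc) (auto simp: link_state_iff)
  with link_state_delete_arc[of M P k] P k M that show thesis by metis
qed (rule that)

lemma finite_link_states: "finite (link_states N j)"
proof -
  have "link_states N j \<subseteq> {p. p permutes {1..N}}"
    by (auto simp: link_states_def link_state_def)
  then show ?thesis by (rule finite_subset) (simp add: finite_permutations)
qed

text \<open>
  Two small arcs can be inserted in either order; the lower one shifts the upper one by two points.
\<close>

lemma insert_arc_commute:
  assumes "k \<le> l"
  shows "insert_arc k (insert_arc l p) = insert_arc (l + 2) (insert_arc k p)"
proof
  fix a
  consider "a < k" | "a = k" | "a = k + 1" | "k + 2 \<le> a" "a < l + 2" | "a = l + 2" | "a = l + 3" | "a > l + 3"
    by linarith
  then show "insert_arc k (insert_arc l p) a = insert_arc (l + 2) (insert_arc k p) a"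
    by cases (use assms in \<open>auto simp: insert_arc_def skip_def unskip_def\<close>)
qed

section \<open>Linear maps between spaces of formal combinations\<close>

definition linear_op :: "(('k \<Rightarrow>\<^sub>0 complex) \<Rightarrow> 'l \<Rightarrow>\<^sub>0 complex) \<Rightarrow> bool" where
  "linear_op f \<longleftrightarrow> (\<forall>v w. f (v + w) = f v + f w) \<and> (\<forall>c v. f (scale c v) = scale c (f v))"

definition lin_ext :: "('k \<Rightarrow> 'l \<Rightarrow>\<^sub>0 complex) \<Rightarrow> ('k \<Rightarrow>\<^sub>0 complex) \<Rightarrow> 'l \<Rightarrow>\<^sub>0 complex" where
  "lin_ext h v = (\<Sum>p\<in>Poly_Mapping.keys v. scale (Poly_Mapping.lookup v p) (h p))"

lemma lookup_scale [simp]: "Poly_Mapping.lookup (scale c v) k = c * Poly_Mapping.lookup v k"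
  by (simp add: scale_def Poly_Mapping.map.rep_eq when_def)

lemma keys_scale: "Poly_Mapping.keys (scale c v) \<subseteq> Poly_Mapping.keys v"
  by (auto simp: in_keys_iff)

lemma scale_simps [simp]:
  "scale 0 v = 0" "scale c 0 = 0" "scale 1 v = v" "scale c (scale d v) = scale (c * d) v"
  "scale c (Poly_Mapping.single k d) = Poly_Mapping.single k (c * d)"
  by (auto intro!: poly_mapping_eqI simp: lookup_single when_def)

lemma scale_add: "scale c (v + w) = scale c v + scale c w" "scale (c + d) v = scale c v + scale d v"
  by (auto intro!: poly_mapping_eqI simp: lookup_add algebra_simps)

lemma scale_sum: "scale c (sum h A) = (\<Sum>a\<in>A. scale c (h a))"
  by (induction A rule: infinite_finite_induct) (auto simp: scale_add)

lemma scalar_mult [simp]: "scalar c * f = scale c f"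
  by (simp add: scalar_def scale_def mult_map_scale_conv_mult)

text \<open>
  Linear statements about combinations supported in \<open>S\<close> need to be checked on multiples of basis
  vectors only.
\<close>

lemma poly_mapping_span_induct [consumes 1, case_names zero single add]:
  fixes v :: "'k \<Rightarrow>\<^sub>0 complex"
  assumes "Poly_Mapping.keys v \<subseteq> S" and "P 0"
    and single: "\<And>p c. p \<in> S \<Longrightarrow> P (Poly_Mapping.single p c)"
    and add: "\<And>v w. P v \<Longrightarrow> P w \<Longrightarrow> Poly_Mapping.keys v \<subseteq> S \<Longrightarrow> Poly_Mapping.keys w \<subseteq> S \<Longrightarrow> P (v + w)"
  shows "P v"
proof -
  have "P (\<Sum>p\<in>A. Poly_Mapping.single p (Poly_Mapping.lookup v p)) \<and>
      Poly_Mapping.keys (\<Sum>p\<in>A. Poly_Mapping.single p (Poly_Mapping.lookup v p)) \<subseteq> S"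
    if "A \<subseteq> S" "finite A" for A
    using that(2,1)
  proof (induction A rule: finite_induct)
    case (insert a A)
    let ?s = "\<Sum>p\<in>A. Poly_Mapping.single p (Poly_Mapping.lookup v p)"
    have "Poly_Mapping.keys (Poly_Mapping.single a (Poly_Mapping.lookup v a)) \<subseteq> S"
      using insert.prems by simp
    moreover have "Poly_Mapping.keys ?s \<subseteq> S"
      using insert.IH insert.prems by blast
    ultimately have "P (Poly_Mapping.single a (Poly_Mapping.lookup v a) + ?s)"
        "Poly_Mapping.keys (Poly_Mapping.single a (Poly_Mapping.lookup v a) + ?s) \<subseteq> S"
      using insert.IH insert.prems
      by (blast intro: add single, intro order.trans[OF Poly_Mapping.keys_add] Un_least)
    then show ?case by (simp add: insert.hyps)
  qed (simp add: \<open>P 0\<close>)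
  moreover have "v = (\<Sum>p\<in>Poly_Mapping.keys v. Poly_Mapping.single p (Poly_Mapping.lookup v p))"
    by (intro poly_mapping_eqI) (auto simp: lookup_sum lookup_single when_def in_keys_iff)
  ultimately show ?thesis using assms(1) by (metis finite_keys)
qed

lemma lin_ext_superset:
  assumes "finite A" "Poly_Mapping.keys v \<subseteq> A"
  shows "lin_ext h v = (\<Sum>p\<in>A. scale (Poly_Mapping.lookup v p) (h p))"
  unfolding lin_ext_def by (rule sum.mono_neutral_left) (use assms in \<open>auto simp: in_keys_iff\<close>)

lemma linear_op_lin_ext: "linear_op (lin_ext h)"
proof -
  have "lin_ext h (v + w) = lin_ext h v + lin_ext h w" for v w
  proof -
    let ?A = "Poly_Mapping.keys v \<union> Poly_Mapping.keys w"
    have "Poly_Mapping.keys (v + w) \<subseteq> ?A" by (rule Poly_Mapping.keys_add)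
    then show ?thesis
      by (simp add: lin_ext_superset[of ?A] lookup_add scale_add sum.distrib)
  qed
  moreover have "lin_ext h (scale c v) = scale c (lin_ext h v)" for c v
    by (simp add: lin_ext_superset[of "Poly_Mapping.keys v"] keys_scale scale_sum)
  ultimately show ?thesis by (simp add: linear_op_def)
qed

lemma linear_opD:
  assumes "linear_op f"
  shows "f (v + w) = f v + f w" "f (scale c v) = scale c (f v)" "f 0 = 0" "f (v - w) = f v - f w"
proof -
  show *: "f (v + w) = f v + f w" "f (scale c v) = scale c (f v)" for v w c
    using assms by (auto simp: linear_op_def)
  show "f 0 = 0" using *(2)[of 0 0] by simp
  show "f (v - w) = f v - f w" using *(1)[of "v - w" w] by (simp add: algebra_simps)
qed

lemma lin_ext_single [simp]: "lin_ext h (Poly_Mapping.single p c) = scale c (h p)"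
  by (simp add: lin_ext_superset[of "{p}"] lookup_single)

lemma linear_op_eqI:
  assumes "linear_op f" "linear_op g" "Poly_Mapping.keys v \<subseteq> S"
    and "\<And>p. p \<in> S \<Longrightarrow> f (Poly_Mapping.single p 1) = g (Poly_Mapping.single p 1)"
  shows "f v = g v"
  using assms(3)
proof (induction rule: poly_mapping_span_induct)
  case (single p c)
  then have "f (scale c (Poly_Mapping.single p 1)) = g (scale c (Poly_Mapping.single p 1))"
    by (simp only: linear_opD[OF assms(1)] linear_opD[OF assms(2)] assms(4))
  then show ?case by simp
qed (simp_all add: linear_opD[OF assms(1)] linear_opD[OF assms(2)])

section \<open>How a generator meets an inserted arc\<close>

lemma gen_action_eq: "gen_action m i = lin_ext (link_action m i)"
  by (simp add: fun_eq_iff gen_action_def lin_ext_def)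

lemma linear_op_gen_action: "linear_op (gen_action m i)"
  by (simp add: gen_action_eq linear_op_lin_ext)

text \<open>
  For generators that do not touch the inserted arc, this map intertwines the actions on \<open>N\<close> and on
  \<open>N + 2\<close> points up to the index shift \<open>skip k\<close>.
\<close>

definition insert_arcs :: "nat \<Rightarrow> (link \<Rightarrow>\<^sub>0 complex) \<Rightarrow> link \<Rightarrow>\<^sub>0 complex" where
  "insert_arcs k = lin_ext (\<lambda>p. Poly_Mapping.single (insert_arc k p) 1)"

lemma insert_arcs_single [simp]:
  "insert_arcs k (Poly_Mapping.single p c) = Poly_Mapping.single (insert_arc k p) c"
  by (simp add: insert_arcs_def)

lemma linear_op_insert_arcs: "linear_op (insert_arcs k)"
  by (simp add: insert_arcs_def linear_op_lin_ext)

lemma link_action_loop: "p i = i + 1 \<Longrightarrow> link_action m i p = Poly_Mapping.single p m"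
  by (simp add: link_action_def)

lemma skip_Suc: "a \<noteq> k \<Longrightarrow> skip (Suc k) a = skip k a"
  by (auto simp: skip_def)

lemma skip_self [simp]: "skip k k = Suc (Suc k)" "skip (Suc k) k = k"
  by (simp_all add: skip_def)

lemma skip_eq_Suc_Suc [simp]: "skip k a = Suc (Suc k) \<longleftrightarrow> a = k" "Suc (Suc k) = skip k a \<longleftrightarrow> a = k"
  by (auto simp: skip_def)

text \<open>
  The points below \<open>k\<close> and above \<open>k + 2\<close> carry the same labels whether an arc is inserted at \<open>k\<close> or at
  \<open>k + 1\<close>; only \<open>k\<close>, \<open>k + 1\<close> and \<open>k + 2\<close> need separate treatment.
\<close>

lemma skip_cases_around:
  obtains "a = k" | "a = k + 1" | "a = k + 2" | b where "a = skip k b" "b \<noteq> k"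
proof (rule skip_cases[of a k])
  fix b assume "a = skip k b"
  then show thesis by (cases "b = k") (use that in auto)
qed (use that in auto)

text \<open>
  The generator \<open>e\<^bsub>k+1\<^esub>\<close> joins the end \<open>k + 1\<close> of the inserted arc to whatever ends at \<open>k + 2\<close>.
  Straightening that line frees its end at \<open>k\<close>, so in effect the arc has moved one step to the right.
\<close>

lemma reconnect_insert_arc_right:
  assumes inv: "\<And>a. p (p a) = a"
  shows "reconnect (k + 1) (insert_arc k p) = insert_arc (k + 1) p"
proof
  fix a
  have up: "insert_arc k p (Suc (Suc k)) = skip k (p k)"
    using insert_arc_simps(3)[of k p k] by simp
  have low: "insert_arc (Suc k) p k = skip (Suc k) (p k)"
    using insert_arc_simps(3)[of "Suc k" p k] by simp
  show "reconnect (k + 1) (insert_arc k p) a = insert_arc (k + 1) p a"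
  proof (rule skip_cases_around[of a k])
    assume a: "a = k"
    show ?thesis by (cases "p k = k") (auto simp: a reconnect_def up low skip_Suc)
  next
    fix b assume a: "a = skip k b" and b: "b \<noteq> k"
    have a': "a = skip (Suc k) b" using a b by (simp add: skip_Suc)
    have vals: "insert_arc k p a = skip k (p b)" "insert_arc (Suc k) p a = skip (Suc k) (p b)"
      using insert_arc_simps(3)[of k p b] insert_arc_simps(3)[of "Suc k" p b]
      unfolding a[symmetric] a'[symmetric] by simp_all
    have "a \<noteq> k" "a \<noteq> Suc k" "a \<noteq> Suc (Suc k)" using a a' skip_neq by metis+
    then have "reconnect (k + 1) (insert_arc k p) a = (if a = skip k (p k) then k else skip k (p b))"
      by (simp add: reconnect_def vals up)
    also have "\<dots> = skip (Suc k) (p b)"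
    proof (cases "p b = k")
      case True
      then have "p k = b" using inv by metis
      then show ?thesis using True a by simp
    next
      case False
      then have "p k \<noteq> b" using inv by metis
      then have "a \<noteq> skip k (p k)" using a by simp
      then show ?thesis using False by (simp add: skip_Suc)
    qed
    finally show ?thesis by (simp add: vals)
  qed (auto simp: reconnect_def)
qed

lemma reconnect_insert_arc_left:
  assumes inv: "\<And>a. p (p a) = a"
  shows "reconnect k (insert_arc (k + 1) p) = insert_arc k p"
proof
  fix a
  have up: "insert_arc k p (Suc (Suc k)) = skip k (p k)"
    using insert_arc_simps(3)[of k p k] by simp
  have low: "insert_arc (Suc k) p k = skip (Suc k) (p k)"
    using insert_arc_simps(3)[of "Suc k" p k] by simp
  show "reconnect k (insert_arc (k + 1) p) a = insert_arc k p a"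
  proof (rule skip_cases_around[of a k])
    assume a: "a = k + 2"
    show ?thesis by (cases "p k = k") (auto simp: a reconnect_def up low skip_Suc)
  next
    fix b assume a: "a = skip k b" and b: "b \<noteq> k"
    have a': "a = skip (Suc k) b" using a b by (simp add: skip_Suc)
    have vals: "insert_arc k p a = skip k (p b)" "insert_arc (Suc k) p a = skip (Suc k) (p b)"
      using insert_arc_simps(3)[of k p b] insert_arc_simps(3)[of "Suc k" p b]
      unfolding a[symmetric] a'[symmetric] by simp_all
    have "a \<noteq> k" "a \<noteq> Suc k" "a \<noteq> Suc (Suc k)" using a a' skip_neq by metis+
    then have "reconnect k (insert_arc (k + 1) p) a = (if a = skip (Suc k) (p k) then Suc (Suc k) else skip (Suc k) (p b))"
      by (simp add: reconnect_def vals low)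
    also have "\<dots> = skip k (p b)"
    proof (cases "p b = k")
      case True
      then have "p k = b" using inv by metis
      then show ?thesis using True a' by simp
    next
      case False
      then have "p k \<noteq> b" using inv by metis
      then have "a \<noteq> skip (Suc k) (p k)" using a' by simp
      then show ?thesis using False by (simp add: skip_Suc)
    qed
    finally show ?thesis by (simp add: vals)
  qed (auto simp: reconnect_def)
qed

lemma link_action_insert_arc_right:
  assumes "\<And>a. p (p a) = a"
  shows "link_action m (k + 1) (insert_arc k p) = Poly_Mapping.single (insert_arc (k + 1) p) 1"
  using reconnect_insert_arc_right[OF assms] by (simp add: link_action_def)

lemma link_action_insert_arc_left:
  assumes "\<And>a. p (p a) = a"
  shows "link_action m k (insert_arc (k + 1) p) = Poly_Mapping.single (insert_arc k p) 1"
proof -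
  have "insert_arc (Suc k) p k \<noteq> k + 1" using skip_neq(3)[of "Suc k" "p k"] by (simp add: insert_arc_def unskip_def)
  then show ?thesis using reconnect_insert_arc_left[OF assms] by (simp add: link_action_def)
qed

text \<open>Away from the inserted arc the action only sees the remaining arcs.\<close>

lemma link_action_insert_arc_far:
  assumes "i + 1 < k \<or> k \<le> i"
  shows "link_action m (skip k i) (insert_arc k p) = insert_arcs k (link_action m i p)"
proof -
  have s: "Suc (skip k i) = skip k (Suc i)" using assms by (auto simp: skip_def)
  have "reconnect (skip k i) (insert_arc k p) = insert_arc k (reconnect i p)"
  proof (rule link_eqI_skip[where k = k])
    fix a
    show "reconnect (skip k i) (insert_arc k p) (skip k a) = insert_arc k (reconnect i p) (skip k a)"
      by (simp add: reconnect_def s)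
  qed (simp_all add: reconnect_def s)
  then show ?thesis by (simp add: link_action_def s linear_opD[OF linear_op_insert_arcs])
qed

section \<open>The Temperley--Lieb relations on link states\<close>

lemma link_states_involution: "p \<in> link_states N j \<Longrightarrow> p (p a) = a"
  by (auto simp: link_states_def link_state_iff)

lemma link_states_arc_bounds:
  assumes "p \<in> link_states N j" "p l = l + 1"
  shows "1 \<le> l" "l + 1 \<le> N"
proof -
  have out: "p a = a" if "a \<notin> {1..N}" for a
    using assms(1) that by (auto simp: link_states_def link_state_iff)
  have "p (l + 1) = l" using link_states_involution[OF assms(1), of l] assms(2) by simp
  then show "1 \<le> l" "l + 1 \<le> N" using out[of l] out[of "l + 1"] assms(2) by force+
qed

lemma link_states_cases:
  assumes "P \<in> link_states N j"
  obtains "P = id"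
  | M k p where "N = M + 2" "1 \<le> k" "k \<le> M + 1" "p \<in> link_states M j" "P = insert_arc k p"
proof -
  have "link_state N P" using assms by (simp add: link_states_def)
  then show thesis
  proof (cases rule: link_state_cases)
    case 1 then show thesis by (rule that)
  next
    case (2 M k p)
    then have "P k = k + 1" by simp
    then have "delete_arc k P \<in> link_states M j"
      using delete_arc_in_link_states(1)[of P M j k] assms 2(1) by simp
    with 2 show thesis by (intro that(2)) auto
  qed
qed

abbreviation link_space :: "nat \<Rightarrow> real \<Rightarrow> (link \<Rightarrow>\<^sub>0 complex) set" where
  "link_space N j \<equiv> {v. Poly_Mapping.keys v \<subseteq> link_states N j}"

lemma linear_op_closed:
  assumes f: "linear_op f" and single: "\<And>p. p \<in> S \<Longrightarrow> Poly_Mapping.keys (f (Poly_Mapping.single p 1)) \<subseteq> T"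
    and v: "Poly_Mapping.keys v \<subseteq> S"
  shows "Poly_Mapping.keys (f v) \<subseteq> T"
  using v
proof (induction rule: poly_mapping_span_induct)
  case (single p c)
  have "f (Poly_Mapping.single p c) = scale c (f (Poly_Mapping.single p 1))"
    using linear_opD(2)[OF f, of c "Poly_Mapping.single p 1"] by simp
  then show ?case using assms(2)[OF single] keys_scale by (metis order.trans)
next
  case (add v w)
  then show ?case
    by (simp add: linear_opD[OF f]) (meson Poly_Mapping.keys_add Un_least order.trans)
qed (simp add: linear_opD[OF f])

lemma insert_arcs_closed:
  assumes "v \<in> link_space N j" "1 \<le> k" "k \<le> N + 1"
  shows "insert_arcs k v \<in> link_space (N + 2) j"
  using linear_op_closed[OF linear_op_insert_arcs, of "link_states N j" k "link_states (N + 2) j" v]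
    insert_arc_in_link_states assms by simp

lemma gen_action_single [simp]: "gen_action m i (Poly_Mapping.single p c) = scale c (link_action m i p)"
  by (simp add: gen_action_eq)

lemmas lin_simps = linear_opD[OF linear_op_gen_action] linear_opD[OF linear_op_insert_arcs]

lemma gen_action_insert_arcs_same: "gen_action m k (insert_arcs k v) = scale m (insert_arcs k v)"
  by (rule linear_op_eqI[where S = UNIV])
    (auto simp: linear_op_def lin_simps scale_add mult.commute link_action_loop)

lemma gen_action_insert_arcs_far:
  assumes "i + 1 < k \<or> k \<le> i"
  shows "gen_action m (skip k i) (insert_arcs k v) = insert_arcs k (gen_action m i v)"
  by (rule linear_op_eqI[where S = UNIV])
    (auto simp: linear_op_def lin_simps link_action_insert_arc_far[OF assms])

lemma gen_action_insert_arcs_right: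
  assumes "v \<in> link_space N j"
  shows "gen_action m (k + 1) (insert_arcs k v) = insert_arcs (k + 1) v"
  by (rule linear_op_eqI[where S = "link_states N j"])
    (use assms in \<open>auto simp: linear_op_def lin_simps link_action_insert_arc_right[simplified] link_states_involution\<close>)

lemma gen_action_insert_arcs_left:
  assumes "v \<in> link_space N j"
  shows "gen_action m k (insert_arcs (k + 1) v) = insert_arcs k v"
  by (rule linear_op_eqI[where S = "link_states N j"])
    (use assms in \<open>auto simp: linear_op_def lin_simps link_action_insert_arc_left[simplified] link_states_involution\<close>)

lemma generator_position_cases:
  fixes i k N :: nat
  assumes "1 \<le> i" "i \<le> N + 1" "1 \<le> k" "k \<le> N + 1"
  obtains (same) "i = k" | (right) "i = k + 1" | (left) "k = i + 1"
  | (far) i' where "i = skip k i'" "i' + 1 < k \<or> k \<le> i'" "1 \<le> i'" "i' < N"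
proof -
  consider "i = k" | "i = k + 1" | "k = i + 1" | "i + 1 < k" | "k + 2 \<le> i" by linarith
  then show thesis
  proof cases
    case 4 then show thesis using far[of i] assms by (simp add: skip_def)
  next
    case 5
    then have "i = skip k (i - 2)" "k \<le> i - 2" "1 \<le> i - 2" "i - 2 < N"
      using assms by (auto simp: skip_def)
    then show thesis using far by blast
  qed (use same right left in auto)
qed

text \<open>
  Planarity and the number of through-lines are preserved because a generator either closes or moves the
  inserted arc or acts on a smaller link state; this avoids following the new connections in \<open>reconnect\<close>.
\<close>

lemma link_action_closed:
  "p \<in> link_states N j \<Longrightarrow> 1 \<le> i \<Longrightarrow> i < N \<Longrightarrow> link_action m i p \<in> link_space N j"
proof (induction N arbitrary: p i rule: less_induct)
  case (less N P i)
  from less.prems(1) show ?case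
  proof (cases rule: link_states_cases)
    case 1
    then show ?thesis by (simp add: link_action_def)
  next
    case (2 M k p)
    have P: "P \<in> link_states N j" by fact
    have ins: "insert_arc l p \<in> link_states N j" if "1 \<le> l" "l \<le> M + 1" for l
      using insert_arc_in_link_states[OF 2(4) that] 2(1) by simp
    have inv: "p (p a) = a" for a using 2(4) link_states_involution by blast
    have i: "1 \<le> i" "i \<le> M + 1" using less.prems 2 by auto
    then show ?thesis using 2(2,3)
    proof (cases rule: generator_position_cases)
      case same
      then show ?thesis using P 2(5) by (simp add: link_action_loop)
    next
      case right
      then show ?thesis using ins[OF i] by (simp add: 2(5) link_action_insert_arc_right[OF inv, simplified])
    next
      case left
      then show ?thesis using ins[OF i] by (simp add: 2(5) link_action_insert_arc_left[OF inv, simplified])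
    next
      case (far i')
      then have "link_action m i' p \<in> link_space M j" using less.IH[of M p i'] 2 by simp
      then show ?thesis using insert_arcs_closed[of _ M j k] 2(1-3)
        by (simp add: 2(5) far(1) link_action_insert_arc_far[OF far(2)])
    qed
  qed
qed

lemma gen_action_closed:
  assumes "v \<in> link_space N j" "1 \<le> i" "i < N"
  shows "gen_action m i v \<in> link_space N j"
  using linear_op_closed[OF linear_op_gen_action, of "link_states N j" m i "link_states N j" v]
    link_action_closed[of _ N j i m] assms by simp

text \<open>Every nonzero result of \<open>e\<^sub>i\<close> carries the arc that \<open>e\<^sub>i\<close> has just created.\<close>

lemma link_action_creates_arc:
  assumes "p \<in> link_states N j" "1 \<le> i" "i < N"
  obtains "link_action m i p = 0"
  | q c where "link_action m i p = Poly_Mapping.single (insert_arc i q) c" "q \<in> link_states (N - 2) j"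
proof -
  obtain M where M: "N = M + 2" using assms by (metis add_2_eq_Suc' less_imp_Suc_add One_nat_def Suc_le_D add_Suc_right plus_nat.simps(2))
  note created = that(2)
  have arc: thesis if "Q \<in> link_states N j" "Q i = i + 1" "link_action m i p = Poly_Mapping.single Q c" for Q c
    using created[of "delete_arc i Q" c] delete_arc_in_link_states[of Q M j i] that M by simp
  consider "link_action m i p = 0" | "p i = i + 1" | "link_action m i p = Poly_Mapping.single (reconnect i p) 1"
    by (metis link_action_def)
  then show thesis
  proof cases
    case 1 then show thesis by (rule that)
  next
    case 2 then show thesis using arc[of p m] assms by (simp add: link_action_loop)
  next
    case 3
    then have "reconnect i p \<in> link_states N j" using link_action_closed[OF assms, of m] by simp
    then show thesis using arc[OF _ _ 3] by (simp add: reconnect_def)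
  qed
qed

lemma gen_action_creates_arc:
  assumes "v \<in> link_space N j" "1 \<le> i" "i < N"
  obtains u where "u \<in> link_space (N - 2) j" "gen_action m i v = insert_arcs i u"
proof -
  have "Poly_Mapping.keys v \<subseteq> link_states N j" using assms by simp
  then have "\<exists>u \<in> link_space (N - 2) j. gen_action m i v = insert_arcs i u"
  proof (induction rule: poly_mapping_span_induct)
    case zero
    then show ?case by (intro bexI[of _ 0]) (simp_all add: lin_simps)
  next
    case (single p c)
    show ?case
    proof (rule link_action_creates_arc[OF single assms(2,3), of m])
      assume "link_action m i p = 0"
      then show ?case by (intro bexI[of _ 0]) (simp_all add: lin_simps)
    next
      fix q d assume "link_action m i p = Poly_Mapping.single (insert_arc i q) d" "q \<in> link_states (N - 2) j"
      then show ?case by (intro bexI[of _ "Poly_Mapping.single q (c * d)"]) simp_all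
    qed
  next
    case (add v w)
    then obtain u u' where u: "Poly_Mapping.keys u \<subseteq> link_states (N - 2) j" "gen_action m i v = insert_arcs i u"
      "Poly_Mapping.keys u' \<subseteq> link_states (N - 2) j" "gen_action m i w = insert_arcs i u'" by auto
    then have "Poly_Mapping.keys (u + u') \<subseteq> link_states (N - 2) j"
      by (meson Poly_Mapping.keys_add Un_least order.trans)
    with u show ?case
      by (intro bexI[of _ "u + u'"]) (simp_all add: lin_simps)
  qed
  with that show thesis by blast
qed

text \<open>
  The relations \<open>e\<^sub>i\<^sup>2 = m e\<^sub>i\<close> and \<open>e\<^sub>i e\<^sub>k e\<^sub>i = e\<^sub>i\<close> are now immediate: after the first \<open>e\<^sub>i\<close> there is an
  arc at \<open>i\<close>, which a second \<open>e\<^sub>i\<close> closes to a loop, whereas \<open>e\<^sub>k\<close> moves it to \<open>k\<close> and \<open>e\<^sub>i\<close> back.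
\<close>

lemma gen_action_square:
  assumes "v \<in> link_space N j" "1 \<le> i" "i < N"
  shows "gen_action m i (gen_action m i v) = scale m (gen_action m i v)"
  using gen_action_creates_arc[OF assms, of m] gen_action_insert_arcs_same by metis

lemma gen_action_braid:
  assumes "v \<in> link_space N j" "1 \<le> i" "i < N" "k = i + 1 \<or> i = k + 1"
  shows "gen_action m i (gen_action m k (gen_action m i v)) = gen_action m i v"
proof -
  obtain u where u: "u \<in> link_space (N - 2) j" "gen_action m i v = insert_arcs i u"
    using gen_action_creates_arc[OF assms(1-3)] by metis
  show ?thesis using assms(4) gen_action_insert_arcs_left[OF u(1)] gen_action_insert_arcs_right[OF u(1)]
    by (auto simp: u(2))
qed

text \<open>
  Induction over a small arc, at \<open>l\<close> say. If both generators avoid the arc, the induction hypothesis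
  applies; if only one touches it, that one closes or moves the arc without seeing the other. The remaining case is
  \<open>{i, k} = {l - 1, l + 1}\<close>, where the two orders put the arc at different ends of the arc created by the
  far generator, with the same result by \<open>insert_arc_commute\<close>.
\<close>

lemma gen_action_commute:
  assumes "v \<in> link_space N j" "1 \<le> i" "i < N" "1 \<le> k" "k < N" "i + 1 < k \<or> k + 1 < i"
  shows "gen_action m i (gen_action m k v) = gen_action m k (gen_action m i v)"
  using assms
proof (induction N arbitrary: v i k rule: less_induct)
  case (less N v i k)
  show ?case
  proof (rule linear_op_eqI[where S = "link_states N j" and v = v
        and f = "\<lambda>v. gen_action m i (gen_action m k v)" and g = "\<lambda>v. gen_action m k (gen_action m i v)"])
    fix P assume "P \<in> link_states N j"
    then show "gen_action m i (gen_action m k (Poly_Mapping.single P 1)) = gen_action m k (gen_action m i (Poly_Mapping.single P 1))"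
    proof (cases rule: link_states_cases)
      case 1
      then show ?thesis by (simp add: link_action_def lin_simps)
    next
      case (2 M l p)
      define w where "w = Poly_Mapping.single p (1 :: complex)"
      have w: "w \<in> link_space M j" using 2(4) by (simp add: w_def)
      \<comment> \<open>The generator \<open>a\<close> moves the inserted arc or, if \<open>a = l\<close>, multiplies by \<open>m\<close>, whatever the rest is.\<close>
      have near: "gen_action m b (gen_action m a (insert_arcs l w)) = gen_action m a (gen_action m b (insert_arcs l w))"
        if a: "a = l \<or> a = l + 1 \<or> l = a + 1" and b: "b = skip l b'" "b' + 1 < l \<or> l \<le> b'" "1 \<le> b'" "b' < M"
          and ab: "a + 1 < b \<or> b + 1 < a" for a b b'
      proof -
        obtain c where c: "gen_action m a (insert_arcs l u) = scale c (insert_arcs a u)" if "u \<in> link_space M j" for u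
        proof (cases "a = l")
          case True
          then show thesis using that[of m] gen_action_insert_arcs_same by simp
        next
          case False
          then show thesis using that[of 1] a gen_action_insert_arcs_left[of _ M j m] gen_action_insert_arcs_right[of _ M j m]
            by auto
        qed
        have "b = skip a b'" "b' + 1 < a \<or> a \<le> b'" using a b ab by (auto simp: skip_def split: if_splits)
        then have "gen_action m b (insert_arcs a w) = insert_arcs a (gen_action m b' w)"
          using gen_action_insert_arcs_far by metis
        moreover have "gen_action m b (insert_arcs l w) = insert_arcs l (gen_action m b' w)"
          using gen_action_insert_arcs_far b by metis
        ultimately show ?thesis
          using c[OF w] c[OF gen_action_closed[OF w b(3,4), of m]] by (simp add: lin_simps)
      qed
      have i: "1 \<le> i" "i \<le> M + 1" and k: "1 \<le> k" "k \<le> M + 1" using less.prems 2 by auto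
      have "gen_action m i (gen_action m k (insert_arcs l w)) = gen_action m k (gen_action m i (insert_arcs l w))"
      proof (cases "\<exists>i'. i = skip l i' \<and> (i' + 1 < l \<or> l \<le> i') \<and> 1 \<le> i' \<and> i' < M")
        case True
        then obtain i' where i': "i = skip l i'" "i' + 1 < l \<or> l \<le> i'" "1 \<le> i'" "i' < M" by blast
        from k 2(2,3) show ?thesis
        proof (cases rule: generator_position_cases)
          case (far k')
          then have "i' + 1 < k' \<or> k' + 1 < i'" using i' less.prems(6) by (auto simp: skip_def split: if_splits)
          then have "gen_action m i' (gen_action m k' w) = gen_action m k' (gen_action m i' w)"
            using less.IH[of M w i' k'] w i' far 2 by simp
          then show ?thesis by (simp add: i'(1) far(1) gen_action_insert_arcs_far[OF i'(2)] gen_action_insert_arcs_far[OF far(2)])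
        qed (use near[OF _ i'] less.prems(6) in auto)
      next
        case False
        with i 2(2,3) have i': "i = l \<or> i = l + 1 \<or> l = i + 1" by (cases rule: generator_position_cases) auto
        from k 2(2,3) show ?thesis
        proof (cases rule: generator_position_cases)
          case (far k')
          then show ?thesis using near[OF i' far] less.prems(6) by auto
        next
          case right
          then have il: "l = i + 1" using i' less.prems(6) by auto
          then have iM: "1 \<le> i" "i < M" using i k right by auto
          obtain u where "gen_action m i w = insert_arcs i u" using gen_action_creates_arc[OF w iM] by metis
          moreover have "insert_arcs (i + 2) (insert_arcs i u) = insert_arcs i (insert_arcs i u)"
            by (rule linear_op_eqI[where S = UNIV])
              (auto simp: linear_op_def lin_simps insert_arc_commute[of i i, simplified])
          ultimately show ?thesis
            using gen_action_insert_arcs_far[of i "i + 2" m w] gen_action_insert_arcs_far[of i i m w]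
              gen_action_insert_arcs_left[OF w, of m i] gen_action_insert_arcs_right[OF w, of m l]
            by (simp add: right il skip_def)
        next
          case left
          then have il: "l = k + 1" "i = k + 2" using i' less.prems(6) by auto
          then have kM: "1 \<le> k" "k < M" using i k by auto
          obtain u where "gen_action m k w = insert_arcs k u" using gen_action_creates_arc[OF w kM] by metis
          moreover have "insert_arcs (k + 2) (insert_arcs k u) = insert_arcs k (insert_arcs k u)"
            by (rule linear_op_eqI[where S = UNIV])
              (auto simp: linear_op_def lin_simps insert_arc_commute[of k k, simplified])
          ultimately show ?thesis
            using gen_action_insert_arcs_far[of k "k + 2" m w] gen_action_insert_arcs_far[of k k m w]
              gen_action_insert_arcs_left[OF w, of m k] gen_action_insert_arcs_right[OF w, of m l]
            by (simp add: il skip_def)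
        qed (use i' less.prems(6) in auto)
      qed
      then show ?thesis by (simp add: w_def 2(5))
    qed
  qed (use less.prems in \<open>auto simp: linear_op_def lin_simps\<close>)
qed

section \<open>Operators of the free algebra\<close>

lemma minus_eq_scale: "- f = scale (- 1) f"
  by (rule poly_mapping_eqI) simp

lemma extend_action_eq: "extend_action g f v = lin_ext (\<lambda>w. foldr g (letters w) v) f"
  by (simp add: extend_action_def lin_ext_def)

lemma extend_action_simps:
  "extend_action g (f + f') v = extend_action g f v + extend_action g f' v"
  "extend_action g (f - f') v = extend_action g f v - extend_action g f' v"
  "extend_action g (scale c f) v = scale c (extend_action g f v)"
  "extend_action g 0 v = 0"
  "extend_action g (Poly_Mapping.single w c) v = scale c (foldr g (letters w) v)"
  by (simp_all add: extend_action_eq linear_opD[OF linear_op_lin_ext])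

lemma extend_action_scalar [simp]: "extend_action g (scalar c) v = scale c v"
  by (simp add: scalar_def extend_action_simps zero_word_def)

lemma extend_action_gen [simp]: "extend_action g (gen i) v = g i v"
  by (simp add: gen_def extend_action_simps)

lemma one_eq_scalar: "(1 :: free_alg) = scalar 1"
  by (simp add: scalar_def single_one)

lemma linear_op_foldr:
  assumes "\<And>i. linear_op (g i)"
  shows "linear_op (foldr g ws)"
  by (induction ws) (simp_all add: linear_op_def linear_opD[OF assms])

lemma linear_op_extend_action:
  assumes g: "\<And>i. linear_op (g i)"
  shows "linear_op (extend_action g f)"
  by (simp add: linear_op_def extend_action_def linear_opD[OF linear_op_foldr, OF g] scale_add scale_sum
      sum.distrib mult.commute)

lemma extend_action_mult:
  assumes g: "\<And>i. linear_op (g i)"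
  shows "extend_action g (f * f') v = extend_action g f (extend_action g f' v)"
proof -
  note lin = linear_opD[OF linear_op_extend_action, of g, OF g] linear_opD[OF linear_op_foldr, of g, OF g]
  have "Poly_Mapping.keys f \<subseteq> UNIV" "Poly_Mapping.keys f' \<subseteq> UNIV" by auto
  then show ?thesis
  proof (induction f rule: poly_mapping_span_induct)
    case (single w c)
    from single(2) show ?case
    proof (induction f' rule: poly_mapping_span_induct)
      case (single w' c')
      show ?case
        by (simp add: mult_single extend_action_simps plus_word_def lin)
    qed (simp_all add: distrib_left extend_action_simps lin scale_add)
  qed (simp_all add: distrib_right extend_action_simps)
qed

section \<open>The Temperley--Lieb algebra by generators and relations\<close>

lemma free_algebra_simps [simp]:
  "monoid.mult (free_algebra N) = (*)" "one (free_algebra N) = 1"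
  "ring.zero (free_algebra N) = 0" "ring.add (free_algebra N) = (+)"
  by (simp_all add: free_algebra_def)

lemma carrier_free_algebra: "carrier (free_algebra N) = {f. Poly_Mapping.keys f \<subseteq> {w. set (letters w) \<subseteq> {1..<N}}}"
  by (auto simp: free_algebra_def)

lemma free_algebra_closed [simp]:
  "0 \<in> carrier (free_algebra N)" "1 \<in> carrier (free_algebra N)" "scalar c \<in> carrier (free_algebra N)"
  "1 \<le> i \<Longrightarrow> i < N \<Longrightarrow> gen i \<in> carrier (free_algebra N)"
  "f \<in> carrier (free_algebra N) \<Longrightarrow> g \<in> carrier (free_algebra N) \<Longrightarrow> f + g \<in> carrier (free_algebra N)"
  "f \<in> carrier (free_algebra N) \<Longrightarrow> - f \<in> carrier (free_algebra N)"
  "f \<in> carrier (free_algebra N) \<Longrightarrow> g \<in> carrier (free_algebra N) \<Longrightarrow> f - g \<in> carrier (free_algebra N)"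
  "f \<in> carrier (free_algebra N) \<Longrightarrow> g \<in> carrier (free_algebra N) \<Longrightarrow> f * g \<in> carrier (free_algebra N)"
  "f \<in> carrier (free_algebra N) \<Longrightarrow> scale c f \<in> carrier (free_algebra N)"
proof -
  have add: "f + g \<in> carrier (free_algebra N)" if "f \<in> carrier (free_algebra N)" "g \<in> carrier (free_algebra N)" for f g
    using that Poly_Mapping.keys_add[of f g] by (auto simp: carrier_free_algebra)
  show "f \<in> carrier (free_algebra N) \<Longrightarrow> g \<in> carrier (free_algebra N) \<Longrightarrow> f + g \<in> carrier (free_algebra N)" by (rule add)
  show uminus: "f \<in> carrier (free_algebra N) \<Longrightarrow> - f \<in> carrier (free_algebra N)" for f
    by (simp add: carrier_free_algebra)
  show "f \<in> carrier (free_algebra N) \<Longrightarrow> g \<in> carrier (free_algebra N) \<Longrightarrow> f - g \<in> carrier (free_algebra N)"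
    using add[of f "- g"] uminus[of g] by simp
  show "f \<in> carrier (free_algebra N) \<Longrightarrow> g \<in> carrier (free_algebra N) \<Longrightarrow> f * g \<in> carrier (free_algebra N)"
    using keys_mult[of f g] by (fastforce simp: carrier_free_algebra plus_word_def)
  show "f \<in> carrier (free_algebra N) \<Longrightarrow> scale c f \<in> carrier (free_algebra N)"
    using keys_scale[of c f] by (auto simp: carrier_free_algebra)
qed (auto simp: carrier_free_algebra one_eq_scalar scalar_def gen_def zero_word_def)

text \<open>
  Every element is a combination of words, and a word arises from a scalar by multiplying with generators
  from the left; that is the side from which the algebra acts.
\<close>

lemma free_algebra_induct [consumes 1, case_names scalar add gen]:
  assumes "f \<in> carrier (free_algebra N)"
    and scalar: "\<And>c. P (scalar c)"
    and add: "\<And>f g. f \<in> carrier (free_algebra N) \<Longrightarrow> g \<in> carrier (free_algebra N) \<Longrightarrow> P f \<Longrightarrow> P g \<Longrightarrow> P (f + g)"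
    and gen: "\<And>i f. 1 \<le> i \<Longrightarrow> i < N \<Longrightarrow> f \<in> carrier (free_algebra N) \<Longrightarrow> P f \<Longrightarrow> P (gen i * f)"
  shows "P f"
proof -
  have word: "Poly_Mapping.single (Word ws) c \<in> carrier (free_algebra N) \<and> P (Poly_Mapping.single (Word ws) c)"
    if "set ws \<subseteq> {1..<N}" for ws c
    using that
  proof (induction ws)
    case Nil
    then show ?case using scalar[of c] free_algebra_closed(3)[of c N] by (simp add: scalar_def zero_word_def)
  next
    case (Cons i ws)
    have "Poly_Mapping.single (Word (i # ws)) c = gen i * Poly_Mapping.single (Word ws) c"
      by (simp add: gen_def mult_single plus_word_def)
    with Cons gen show ?case by simp
  qed
  have "Poly_Mapping.keys f \<subseteq> {w. set (letters w) \<subseteq> {1..<N}}"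
    using assms(1) by (simp add: carrier_free_algebra)
  then show ?thesis
  proof (induction rule: poly_mapping_span_induct)
    case zero
    then show ?case using scalar[of 0] by (simp add: scalar_def)
  next
    case (single w c)
    then show ?case using word[of "letters w"] by simp
  next
    case (add v w)
    then show ?case using assms(3) by (simp add: carrier_free_algebra)
  qed
qed

lemma ring_free_algebra: "ring (free_algebra N)"
proof (rule ringI)
  show "abelian_group (free_algebra N)"
  proof (rule abelian_groupI)
    fix f assume "f \<in> carrier (free_algebra N)"
    then show "\<exists>g\<in>carrier (free_algebra N). g \<oplus>\<^bsub>free_algebra N\<^esub> f = \<zero>\<^bsub>free_algebra N\<^esub>"
      by (intro bexI[of _ "- f"]) simp_all
  qed (simp_all add: algebra_simps)
  show "Group.monoid (free_algebra N)"
    by (rule monoidI) (simp_all add: mult.assoc)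
qed (simp_all add: algebra_simps)

lemma tl_relations_subset: "tl_relations N m \<subseteq> carrier (free_algebra N)"
  by (auto simp: tl_relations_def)

lemma tl_relationsI:
  "1 \<le> i \<Longrightarrow> i < N \<Longrightarrow> gen i * gen i - scalar m * gen i \<in> tl_relations N m"
  "1 \<le> i \<Longrightarrow> i < N \<Longrightarrow> 1 \<le> k \<Longrightarrow> k < N \<Longrightarrow> k = i + 1 \<or> i = k + 1 \<Longrightarrow>
     gen i * gen k * gen i - gen i \<in> tl_relations N m"
  "1 \<le> i \<Longrightarrow> i < N \<Longrightarrow> 1 \<le> k \<Longrightarrow> k < N \<Longrightarrow> i + 1 < k \<or> k + 1 < i \<Longrightarrow>
     gen i * gen k - gen k * gen i \<in> tl_relations N m"
  unfolding tl_relations_def atLeastLessThan_iff by blast+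

lemma ideal_tl_ideal: "ideal (tl_ideal N m) (free_algebra N)"
  unfolding tl_ideal_def by (rule ring.genideal_ideal[OF ring_free_algebra tl_relations_subset])

lemma tl_relations_in_ideal: "r \<in> tl_relations N m \<Longrightarrow> r \<in> tl_ideal N m"
  unfolding tl_ideal_def using ring.genideal_self[OF ring_free_algebra tl_relations_subset] by blast

lemma a_minus_free_algebra [simp]: "f \<in> carrier (free_algebra N) \<Longrightarrow> a_inv (free_algebra N) f = - f"
  by (rule abelian_group.minus_equality[OF ring.is_abelian_group[OF ring_free_algebra]]) simp_all

lemma tl_ideal_closed:
  "0 \<in> tl_ideal N m"
  "f \<in> tl_ideal N m \<Longrightarrow> f \<in> carrier (free_algebra N)"
  "f \<in> tl_ideal N m \<Longrightarrow> g \<in> tl_ideal N m \<Longrightarrow> f + g \<in> tl_ideal N m"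
  "f \<in> tl_ideal N m \<Longrightarrow> - f \<in> tl_ideal N m"
  "f \<in> tl_ideal N m \<Longrightarrow> g \<in> tl_ideal N m \<Longrightarrow> f - g \<in> tl_ideal N m"
  "f \<in> tl_ideal N m \<Longrightarrow> h \<in> carrier (free_algebra N) \<Longrightarrow> h * f \<in> tl_ideal N m"
  "f \<in> tl_ideal N m \<Longrightarrow> h \<in> carrier (free_algebra N) \<Longrightarrow> f * h \<in> tl_ideal N m"
proof -
  interpret I: ideal "tl_ideal N m" "free_algebra N" by (rule ideal_tl_ideal)
  show "0 \<in> tl_ideal N m" using additive_subgroup.zero_closed[OF ideal.axioms(1)[OF ideal_tl_ideal]] unfolding free_algebra_simps .
  show *: "f \<in> tl_ideal N m \<Longrightarrow> f \<in> carrier (free_algebra N)" for f by (rule I.a_Hcarr)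
  show add: "f \<in> tl_ideal N m \<Longrightarrow> g \<in> tl_ideal N m \<Longrightarrow> f + g \<in> tl_ideal N m" for f g
    using additive_subgroup.a_closed[OF ideal.axioms(1)[OF ideal_tl_ideal]] unfolding free_algebra_simps .
  show inv: "f \<in> tl_ideal N m \<Longrightarrow> - f \<in> tl_ideal N m" for f
    using additive_subgroup.a_inv_closed[OF ideal.axioms(1)[OF ideal_tl_ideal], of f N m]
      *[of f] a_minus_free_algebra[of f N] ring.is_abelian_group[OF ring_free_algebra] by metis
  show "f \<in> tl_ideal N m \<Longrightarrow> g \<in> tl_ideal N m \<Longrightarrow> f - g \<in> tl_ideal N m"
    using add[of f "- g"] inv[of g] by simp
  show "f \<in> tl_ideal N m \<Longrightarrow> h \<in> carrier (free_algebra N) \<Longrightarrow> h * f \<in> tl_ideal N m"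
    using I.I_l_closed[of f h] unfolding free_algebra_simps .
  show "f \<in> tl_ideal N m \<Longrightarrow> h \<in> carrier (free_algebra N) \<Longrightarrow> f * h \<in> tl_ideal N m"
    using I.I_r_closed[of f h] unfolding free_algebra_simps .
qed

lemma tl_class_eq: "tl_class N m f = (\<lambda>h. h + f) ` tl_ideal N m"
  by (auto simp: tl_class_def a_r_coset_def')

lemma tl_class_eq_iff:
  "tl_class N m f = tl_class N m g \<longleftrightarrow> f - g \<in> tl_ideal N m"
proof
  assume "tl_class N m f = tl_class N m g"
  moreover have "f \<in> tl_class N m f" by (auto simp: tl_class_eq tl_ideal_closed intro: image_eqI[of _ _ 0])
  ultimately show "f - g \<in> tl_ideal N m" by (auto simp: tl_class_eq)
next
  have *: "tl_class N m f \<subseteq> tl_class N m g" if d: "f - g \<in> tl_ideal N m" for f g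
  proof
    fix x assume "x \<in> tl_class N m f"
    then obtain h where "h \<in> tl_ideal N m" "x = h + f" by (auto simp: tl_class_eq)
    then show "x \<in> tl_class N m g"
      unfolding tl_class_eq using tl_ideal_closed(3)[OF _ d] by (intro image_eqI[of _ _ "h + (f - g)"]) simp_all
  qed
  assume d: "f - g \<in> tl_ideal N m"
  then have "g - f \<in> tl_ideal N m" using tl_ideal_closed(4) by force
  with d show "tl_class N m f = tl_class N m g" using * by blast
qed

lemma ring_TL: "ring (TL N m)"
  unfolding TL_def by (rule ideal.quotient_is_ring[OF ideal_tl_ideal])

lemma carrier_TL: "carrier (TL N m) = tl_class N m ` carrier (free_algebra N)"
  by (auto simp: TL_def FactRing_def A_RCOSETS_def' tl_class_def)

lemma tl_class_closed [simp]: "f \<in> carrier (free_algebra N) \<Longrightarrow> tl_class N m f \<in> carrier (TL N m)"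
  by (simp add: carrier_TL)

lemma TL_simps:
  "f \<in> carrier (free_algebra N) \<Longrightarrow> g \<in> carrier (free_algebra N) \<Longrightarrow>
     tl_class N m f \<otimes>\<^bsub>TL N m\<^esub> tl_class N m g = tl_class N m (f * g)"
  "f \<in> carrier (free_algebra N) \<Longrightarrow> g \<in> carrier (free_algebra N) \<Longrightarrow>
     tl_class N m f \<oplus>\<^bsub>TL N m\<^esub> tl_class N m g = tl_class N m (f + g)"
  "\<one>\<^bsub>TL N m\<^esub> = tl_class N m 1"
  "\<zero>\<^bsub>TL N m\<^esub> = tl_class N m 0"
proof -
  interpret I: ideal "tl_ideal N m" "free_algebra N" by (rule ideal_tl_ideal)
  show "f \<in> carrier (free_algebra N) \<Longrightarrow> g \<in> carrier (free_algebra N) \<Longrightarrow>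
     tl_class N m f \<otimes>\<^bsub>TL N m\<^esub> tl_class N m g = tl_class N m (f * g)"
    using I.rcoset_mult_add[of f g] by (simp add: TL_def FactRing_def tl_class_def)
  show "f \<in> carrier (free_algebra N) \<Longrightarrow> g \<in> carrier (free_algebra N) \<Longrightarrow>
     tl_class N m f \<oplus>\<^bsub>TL N m\<^esub> tl_class N m g = tl_class N m (f + g)"
    using I.a_rcos_sum[of f g] by (simp add: TL_def FactRing_def tl_class_def)
qed (simp_all add: TL_def FactRing_def tl_class_def flip: tl_class_def, simp add: tl_class_eq)

text \<open>
  Functions on the quotient are defined through \<open>the_elem\<close> of an image; this evaluates them on any
  representative once they are constant on classes.
\<close>

lemma the_elem_image_tl_class:
  assumes "\<And>h. h \<in> tl_ideal N m \<Longrightarrow> F (h + f) = F f"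
  shows "the_elem (F ` tl_class N m f) = F f"
proof -
  have "F ` tl_class N m f = {F f}"
    using assms tl_ideal_closed(1)[of N m] by (auto simp: tl_class_eq image_image)
  then show ?thesis by simp
qed

text \<open>
  The elements with property \<open>P\<close> must be shown to form an ideal: the ideal is generated from the
  relations with respect to two-sided multiplication by the whole free algebra.
\<close>

lemma tl_ideal_induct [consumes 1, case_names closed relation]:
  assumes "f \<in> tl_ideal N m" and "ideal {f \<in> carrier (free_algebra N). P f} (free_algebra N)"
    and "\<And>r. r \<in> tl_relations N m \<Longrightarrow> P r"
  shows "P f"
proof -
  have "tl_ideal N m \<subseteq> {f \<in> carrier (free_algebra N). P f}"
    unfolding tl_ideal_def
    by (rule ring.genideal_minimal[OF ring_free_algebra assms(2)]) (use assms(3) tl_relations_subset in auto)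
  with assms(1) show ?thesis by blast
qed

text \<open>
  This covers both genuine representations (\<open>Z = {0}\<close>) and homomorphisms into another quotient
  (\<open>Z\<close> its ideal), since the generators need to satisfy the relations on \<open>V\<close> modulo \<open>Z\<close> only.
\<close>

lemma extend_action_tl_ideal:
  fixes V Z :: "('k \<Rightarrow>\<^sub>0 complex) set"
  assumes lin: "\<And>i. linear_op (g i)"
    and V: "\<And>v w. v \<in> V \<Longrightarrow> w \<in> V \<Longrightarrow> v + w \<in> V" "\<And>c v. v \<in> V \<Longrightarrow> scale c v \<in> V"
      "\<And>i v. 1 \<le> i \<Longrightarrow> i < N \<Longrightarrow> v \<in> V \<Longrightarrow> g i v \<in> V"
    and Z: "0 \<in> Z" "\<And>v w. v \<in> Z \<Longrightarrow> w \<in> Z \<Longrightarrow> v + w \<in> Z" "\<And>c v. v \<in> Z \<Longrightarrow> scale c v \<in> Z"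
      "\<And>i v. 1 \<le> i \<Longrightarrow> i < N \<Longrightarrow> v \<in> Z \<Longrightarrow> g i v \<in> Z"
    and square: "\<And>i v. 1 \<le> i \<Longrightarrow> i < N \<Longrightarrow> v \<in> V \<Longrightarrow> g i (g i v) - scale m (g i v) \<in> Z"
    and braid: "\<And>i k v. 1 \<le> i \<Longrightarrow> i < N \<Longrightarrow> 1 \<le> k \<Longrightarrow> k < N \<Longrightarrow> k = i + 1 \<or> i = k + 1 \<Longrightarrow> v \<in> V \<Longrightarrow>
      g i (g k (g i v)) - g i v \<in> Z"
    and comm: "\<And>i k v. 1 \<le> i \<Longrightarrow> i < N \<Longrightarrow> 1 \<le> k \<Longrightarrow> k < N \<Longrightarrow> i + 1 < k \<or> k + 1 < i \<Longrightarrow> v \<in> V \<Longrightarrow>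
      g i (g k v) - g k (g i v) \<in> Z"
    and f: "f \<in> tl_ideal N m" and v: "v \<in> V"
  shows "extend_action g f v \<in> Z"
proof -
  note mult = extend_action_mult[of g, OF lin]
  have closed: "extend_action g h v \<in> U"
    if "h \<in> carrier (free_algebra N)" "v \<in> U" and U: "\<And>v w. v \<in> U \<Longrightarrow> w \<in> U \<Longrightarrow> v + w \<in> U"
      "\<And>c v. v \<in> U \<Longrightarrow> scale c v \<in> U" "\<And>i v. 1 \<le> i \<Longrightarrow> i < N \<Longrightarrow> v \<in> U \<Longrightarrow> g i v \<in> U" for h v U
    using that(1) by (induction rule: free_algebra_induct) (simp_all add: extend_action_simps mult that)
  note closedV = closed[OF _ _ V] and closedZ = closed[OF _ _ Z(2-4)]
  from f have "\<forall>v\<in>V. extend_action g f v \<in> Z"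
  proof (induction rule: tl_ideal_induct)
    case closed
    show ?case
    proof (rule idealI[OF ring_free_algebra])
      show "subgroup {f \<in> carrier (free_algebra N). \<forall>v\<in>V. extend_action g f v \<in> Z} (add_monoid (free_algebra N))"
      proof (rule group.subgroupI[OF abelian_group.a_group[OF ring.is_abelian_group[OF ring_free_algebra]]])
        fix a assume a: "a \<in> {f \<in> carrier (free_algebra N). \<forall>v\<in>V. extend_action g f v \<in> Z}"
        have "extend_action g (- a) v \<in> Z" if "v \<in> V" for v
          using a that Z(3)[of "extend_action g a v" "-1"]
          by (simp add: minus_eq_scale[of a] extend_action_simps)
        moreover have inv: "inv\<^bsub>add_monoid (free_algebra N)\<^esub> a = - a"
          using a a_minus_free_algebra[of a N] unfolding a_inv_def by blast
        ultimately show "inv\<^bsub>add_monoid (free_algebra N)\<^esub> a \<in> {f \<in> carrier (free_algebra N). \<forall>v\<in>V. extend_action g f v \<in> Z}"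
          using a unfolding inv by simp
      qed (auto simp: extend_action_simps Z intro!: exI[of _ "0 :: free_alg"])
    qed (auto simp: mult intro: closedV closedZ)
  next
    case (relation r)
    then show ?case
      using square braid comm by (auto simp: tl_relations_def extend_action_simps mult)
  qed
  with v show ?thesis by blast
qed

section \<open>Standard modules\<close>

lemma link_space_closed:
  "0 \<in> link_space N j"
  "v \<in> link_space N j \<Longrightarrow> w \<in> link_space N j \<Longrightarrow> v + w \<in> link_space N j"
  "v \<in> link_space N j \<Longrightarrow> scale c v \<in> link_space N j"
  using Poly_Mapping.keys_add[of v w] keys_scale[of c v] by auto

abbreviation tl_action :: "complex \<Rightarrow> free_alg \<Rightarrow> (link \<Rightarrow>\<^sub>0 complex) \<Rightarrow> link \<Rightarrow>\<^sub>0 complex" where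
  "tl_action m \<equiv> extend_action (gen_action m)"

lemma tl_action_tl_ideal:
  assumes "f \<in> tl_ideal N m" "v \<in> link_space N j"
  shows "tl_action m f v = 0"
proof -
  have "tl_action m f v \<in> {0}"
    by (rule extend_action_tl_ideal[where V = "link_space N j", OF linear_op_gen_action _ _ _ _ _ _ _ _ _ _ assms])
      (use gen_action_closed gen_action_square[of _ N j] gen_action_braid[of _ N j] gen_action_commute[of _ N j] link_space_closed
        in \<open>simp_all add: lin_simps\<close>)
  then show ?thesis by simp
qed

lemma tl_action_closed:
  assumes "f \<in> carrier (free_algebra N)" "v \<in> link_space N j"
  shows "tl_action m f v \<in> link_space N j"
  using assms(1)
proof (induction rule: free_algebra_induct)
  case (gen i f)
  then show ?case using gen_action_closed by (simp add: extend_action_mult[OF linear_op_gen_action])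
qed (use link_space_closed assms(2) in \<open>simp_all add: extend_action_simps\<close>)

lemma standard_module_simps:
  "carrier (standard_module N m j) = link_space N j"
  "ring.zero (standard_module N m j) = 0" "ring.add (standard_module N m j) = (+)"
  by (simp_all add: standard_module_def)

lemma standard_module_smult:
  assumes "f \<in> carrier (free_algebra N)" "v \<in> link_space N j"
  shows "tl_class N m f \<odot>\<^bsub>standard_module N m j\<^esub> v = tl_action m f v"
  using the_elem_image_tl_class[of N m "\<lambda>f. tl_action m f v" f] tl_action_tl_ideal[OF _ assms(2)]
  by (simp add: standard_module_def extend_action_simps)

lemma abelian_group_standard_module: "abelian_group (standard_module N m j)"
proof (rule abelian_groupI)
  fix v assume v: "v \<in> carrier (standard_module N m j)"
  show "\<exists>w\<in>carrier (standard_module N m j). w \<oplus>\<^bsub>standard_module N m j\<^esub> v = \<zero>\<^bsub>standard_module N m j\<^esub>"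
    by (intro bexI[of _ "- v"]) (use v in \<open>simp_all add: standard_module_simps\<close>)
qed (use link_space_closed in \<open>simp_all add: standard_module_simps algebra_simps\<close>)

lemma TL_cases:
  assumes "a \<in> carrier (TL N m)"
  obtains f where "f \<in> carrier (free_algebra N)" "a = tl_class N m f"
  using assms by (auto simp: carrier_TL)

lemma left_module_standard_module: "left_module (TL N m) (standard_module N m j)"
proof (intro left_module.intro left_module_axioms.intro ring_TL abelian_group_standard_module)
  note lin = linear_opD[OF linear_op_extend_action, OF linear_op_gen_action]
  note simps = TL_simps standard_module_simps standard_module_smult tl_action_closed link_space_closed
    extend_action_simps extend_action_mult[OF linear_op_gen_action] lin
  let ?M = "standard_module N m j"
  show "\<one>\<^bsub>TL N m\<^esub> \<odot>\<^bsub>?M\<^esub> v = v" if "v \<in> carrier ?M" for v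
    using that standard_module_smult[of 1 N v j m] unfolding standard_module_simps TL_simps one_eq_scalar
    by simp
  fix a v assume a: "a \<in> carrier (TL N m)" and v: "v \<in> carrier ?M"
  from a obtain f where f: "f \<in> carrier (free_algebra N)" "a = tl_class N m f" by (rule TL_cases)
  have v: "v \<in> link_space N j" using v unfolding simps .
  show "a \<odot>\<^bsub>?M\<^esub> v \<in> carrier ?M"
    using f v by (simp only: simps)
  show "a \<odot>\<^bsub>?M\<^esub> (v \<oplus>\<^bsub>?M\<^esub> w) = a \<odot>\<^bsub>?M\<^esub> v \<oplus>\<^bsub>?M\<^esub> a \<odot>\<^bsub>?M\<^esub> w" if "w \<in> carrier ?M" for w
    using f v that by (simp only: simps)
  fix b assume b: "b \<in> carrier (TL N m)"
  from b obtain g where g: "g \<in> carrier (free_algebra N)" "b = tl_class N m g" by (rule TL_cases)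
  show "(a \<oplus>\<^bsub>TL N m\<^esub> b) \<odot>\<^bsub>?M\<^esub> v = a \<odot>\<^bsub>?M\<^esub> v \<oplus>\<^bsub>?M\<^esub> b \<odot>\<^bsub>?M\<^esub> v"
    using f g v by (simp only: simps free_algebra_closed)
  show "(a \<otimes>\<^bsub>TL N m\<^esub> b) \<odot>\<^bsub>?M\<^esub> v = a \<odot>\<^bsub>?M\<^esub> (b \<odot>\<^bsub>?M\<^esub> v)"
    using f g v by (simp only: simps free_algebra_closed)
qed

section \<open>Tensoring a bimodule with a module\<close>

text \<open>
  The tensor product is formed over \<open>R\<close>, and \<open>S\<close> acts through the left factor.
\<close>

locale tensor_bimodule = P: left_module S P + M: abelian_group M
  for S :: "('s, 't) ring_scheme" and P :: "('s, 'p, 'c) module_scheme"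
    and R :: "('a, 'r) ring_scheme" and ract :: "'p \<Rightarrow> 'a \<Rightarrow> 'p" and M :: "('a, 'b, 'd) module_scheme" +
  assumes ract_closed: "x \<in> carrier P \<Longrightarrow> r \<in> carrier R \<Longrightarrow> ract x r \<in> carrier P"
    and smult_ract: "a \<in> carrier S \<Longrightarrow> x \<in> carrier P \<Longrightarrow> r \<in> carrier R \<Longrightarrow>
      a \<odot>\<^bsub>P\<^esub> ract x r = ract (a \<odot>\<^bsub>P\<^esub> x) r"
    and M_smult_closed: "r \<in> carrier R \<Longrightarrow> v \<in> carrier M \<Longrightarrow> r \<odot>\<^bsub>M\<^esub> v \<in> carrier M"
begin

abbreviation "F \<equiv> free_Abelian_group (carrier P \<times> carrier M)"
abbreviation "K \<equiv> generate F (tensor_relations R P ract M)"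
abbreviation "T \<equiv> tensor_product R P ract M"

definition coset :: "('p \<times> 'b \<Rightarrow>\<^sub>0 int) \<Rightarrow> ('p \<times> 'b \<Rightarrow>\<^sub>0 int) set" where
  "coset c = K #>\<^bsub>F\<^esub> c"

definition tens :: "'p \<Rightarrow> 'b \<Rightarrow> ('p \<times> 'b \<Rightarrow>\<^sub>0 int) set" where
  "tens x v = coset (frag_of (x, v))"

definition left_mult :: "'s \<Rightarrow> ('p \<times> 'b \<Rightarrow>\<^sub>0 int) \<Rightarrow> 'p \<times> 'b \<Rightarrow>\<^sub>0 int" where
  "left_mult a = frag_extend (\<lambda>(x, v). frag_of (a \<odot>\<^bsub>P\<^esub> x, v))"

sublocale F: comm_group F by (rule abelian_free_Abelian_group)

lemma F_diff_closed [simp]: "c \<in> carrier F \<Longrightarrow> d \<in> carrier F \<Longrightarrow> c - d \<in> carrier F"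
  using keys_diff[of c d] by auto

lemma F_add_closed [simp]: "c \<in> carrier F \<Longrightarrow> d \<in> carrier F \<Longrightarrow> c + d \<in> carrier F"
  using F.m_closed[of c d] by simp

lemma tensor_relations_subset: "tensor_relations R P ract M \<subseteq> carrier F"
proof -
  have 1: "frag_of (x \<oplus>\<^bsub>P\<^esub> y, v) - frag_of (x, v) - frag_of (y, v) \<in> carrier F"
    if "x \<in> carrier P" "y \<in> carrier P" "v \<in> carrier M" for x y v
    by (intro F_diff_closed) (use that in simp_all)
  have 2: "frag_of (x, v \<oplus>\<^bsub>M\<^esub> w) - frag_of (x, v) - frag_of (x, w) \<in> carrier F"
    if "x \<in> carrier P" "v \<in> carrier M" "w \<in> carrier M" for x v w
    by (intro F_diff_closed) (use that in simp_all)
  have 3: "frag_of (ract x r, v) - frag_of (x, r \<odot>\<^bsub>M\<^esub> v) \<in> carrier F"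
    if "x \<in> carrier P" "r \<in> carrier R" "v \<in> carrier M" for x r v
    by (intro F_diff_closed) (use that ract_closed M_smult_closed in simp_all)
  show ?thesis
    unfolding tensor_relations_def
    by (intro Un_least subsetI; elim CollectE exE conjE; simp only: 1 2 3)
qed

lemma subgroup_K: "subgroup K F"
  by (rule F.generate_is_subgroup[OF tensor_relations_subset])

lemma normal_K: "K \<lhd> F"
  using F.normal_iff_subgroup subgroup_K by blast

lemma K_closed:
  "0 \<in> K" "c \<in> K \<Longrightarrow> d \<in> K \<Longrightarrow> c + d \<in> K" "c \<in> K \<Longrightarrow> c \<in> carrier F" "c \<in> K \<Longrightarrow> - c \<in> K"
  "c \<in> K \<Longrightarrow> d \<in> K \<Longrightarrow> c - d \<in> K"
proof -
  show "0 \<in> K" using subgroup.one_closed[OF subgroup_K] by simp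
  show add: "c \<in> K \<Longrightarrow> d \<in> K \<Longrightarrow> c + d \<in> K" for c d using subgroup.m_closed[OF subgroup_K] by simp
  show carr: "c \<in> K \<Longrightarrow> c \<in> carrier F" for c by (rule subgroup.mem_carrier[OF subgroup_K])
  show inv: "c \<in> K \<Longrightarrow> - c \<in> K" for c using subgroup.m_inv_closed[OF subgroup_K, of c] carr[of c] by simp
  show "c \<in> K \<Longrightarrow> d \<in> K \<Longrightarrow> c - d \<in> K" using add[of c "- d"] inv by simp
qed

lemma coset_eq: "coset c = (\<lambda>k. k + c) ` K"
  by (auto simp: coset_def r_coset_def)

lemma coset_eq_iff: "coset c = coset d \<longleftrightarrow> c - d \<in> K"
proof
  assume "coset c = coset d"
  moreover have "c \<in> coset c" by (auto simp: coset_eq K_closed intro: image_eqI[of _ _ 0])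
  ultimately show "c - d \<in> K" by (auto simp: coset_eq)
next
  have *: "coset c \<subseteq> coset d" if d: "c - d \<in> K" for c d
  proof
    fix x assume "x \<in> coset c"
    then obtain k where "k \<in> K" "x = k + c" by (auto simp: coset_eq)
    then show "x \<in> coset d"
      unfolding coset_eq using K_closed(2)[OF _ d] by (intro image_eqI[of _ _ "k + (c - d)"]) simp_all
  qed
  assume d: "c - d \<in> K"
  then have "d - c \<in> K" using K_closed(4) by force
  with d show "coset c = coset d" using * by blast
qed

lemma carrier_T: "carrier T = coset ` carrier F"
  by (simp add: tensor_product_def Let_def carrier_FactGroup coset_def[abs_def])

lemma T_add: "c \<in> carrier F \<Longrightarrow> d \<in> carrier F \<Longrightarrow> coset c \<oplus>\<^bsub>T\<^esub> coset d = coset (c + d)"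
  using normal.rcos_sum[OF normal_K, of c d] by (simp add: tensor_product_def Let_def coset_def)

lemma T_zero: "\<zero>\<^bsub>T\<^esub> = coset 0"
  by (simp add: tensor_product_def Let_def coset_eq)

lemma abelian_group_T: "abelian_group T"
proof (rule abelian_groupI)
  show "\<zero>\<^bsub>T\<^esub> \<in> carrier T" by (auto simp: T_zero carrier_T)
  fix g assume "g \<in> carrier T"
  then obtain c where c: "c \<in> carrier F" "g = coset c" by (auto simp: carrier_T)
  have z: "0 \<in> carrier F" "- c \<in> carrier F" using c(1) by simp_all
  show "\<zero>\<^bsub>T\<^esub> \<oplus>\<^bsub>T\<^esub> g = g" using c z by (simp only: T_zero T_add) simp
  show "\<exists>h\<in>carrier T. h \<oplus>\<^bsub>T\<^esub> g = \<zero>\<^bsub>T\<^esub>"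
    by (rule bexI[of _ "coset (- c)"]) (use c z in \<open>simp_all only: T_zero T_add carrier_T imageI left_minus\<close>)
  fix h assume "h \<in> carrier T"
  then obtain d where d: "d \<in> carrier F" "h = coset d" by (auto simp: carrier_T)
  show "g \<oplus>\<^bsub>T\<^esub> h \<in> carrier T" using c d by (simp only: T_add carrier_T imageI F_add_closed)
  show "g \<oplus>\<^bsub>T\<^esub> h = h \<oplus>\<^bsub>T\<^esub> g" using c d by (simp only: T_add add.commute)
  fix k assume "k \<in> carrier T"
  then obtain e where e: "e \<in> carrier F" "k = coset e" by (auto simp: carrier_T)
  show "g \<oplus>\<^bsub>T\<^esub> h \<oplus>\<^bsub>T\<^esub> k = g \<oplus>\<^bsub>T\<^esub> (h \<oplus>\<^bsub>T\<^esub> k)"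
    using c d e by (simp only: T_add F_add_closed add.assoc)
qed

lemma left_mult_simps:
  "left_mult a (c + d) = left_mult a c + left_mult a d"
  "left_mult a (c - d) = left_mult a c - left_mult a d"
  "left_mult a (frag_of (x, v)) = frag_of (a \<odot>\<^bsub>P\<^esub> x, v)" "left_mult a 0 = 0"
  by (simp_all add: left_mult_def frag_extend_add frag_extend_diff)

lemma left_mult_closed:
  assumes "a \<in> carrier S" "c \<in> carrier F"
  shows "left_mult a c \<in> carrier F"
proof -
  have "Poly_Mapping.keys c \<subseteq> carrier P \<times> carrier M" using assms(2) by simp
  then show ?thesis
  proof (induction rule: frag_induction)
    case (one z)
    then show ?case using assms(1) by (cases z) (simp add: left_mult_simps P.smult_closed)
  qed (simp_all only: left_mult_simps F_diff_closed, simp)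
qed

lemma tensor_relationsI:
  "x \<in> carrier P \<Longrightarrow> y \<in> carrier P \<Longrightarrow> v \<in> carrier M \<Longrightarrow>
     frag_of (x \<oplus>\<^bsub>P\<^esub> y, v) - frag_of (x, v) - frag_of (y, v) \<in> tensor_relations R P ract M"
  "x \<in> carrier P \<Longrightarrow> v \<in> carrier M \<Longrightarrow> w \<in> carrier M \<Longrightarrow>
     frag_of (x, v \<oplus>\<^bsub>M\<^esub> w) - frag_of (x, v) - frag_of (x, w) \<in> tensor_relations R P ract M"
  "x \<in> carrier P \<Longrightarrow> r \<in> carrier R \<Longrightarrow> v \<in> carrier M \<Longrightarrow>
     frag_of (ract x r, v) - frag_of (x, r \<odot>\<^bsub>M\<^esub> v) \<in> tensor_relations R P ract M"
  unfolding tensor_relations_def by blast+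

text \<open>
  This is where commutation of the two actions on \<open>P\<close> enters: it keeps the balancing relation.
\<close>

lemma left_mult_tensor_relations:
  assumes "a \<in> carrier S" "r \<in> tensor_relations R P ract M"
  shows "left_mult a r \<in> tensor_relations R P ract M"
  using assms(2) unfolding tensor_relations_def
proof (elim UnE CollectE exE conjE, fold tensor_relations_def)
  fix x y v assume *: "r = frag_of (x \<oplus>\<^bsub>P\<^esub> y, v) - frag_of (x, v) - frag_of (y, v)"
    "x \<in> carrier P" "y \<in> carrier P" "v \<in> carrier M"
  then show "left_mult a r \<in> tensor_relations R P ract M"
    using tensor_relationsI(1)[of "a \<odot>\<^bsub>P\<^esub> x" "a \<odot>\<^bsub>P\<^esub> y" v] assms(1)
    by (simp add: left_mult_simps P.smult_closed P.smult_r_distr)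
next
  fix x v w assume *: "r = frag_of (x, v \<oplus>\<^bsub>M\<^esub> w) - frag_of (x, v) - frag_of (x, w)"
    "x \<in> carrier P" "v \<in> carrier M" "w \<in> carrier M"
  then show "left_mult a r \<in> tensor_relations R P ract M"
    using tensor_relationsI(2)[of "a \<odot>\<^bsub>P\<^esub> x" v w] assms(1)
    by (simp add: left_mult_simps P.smult_closed)
next
  fix x s v assume *: "r = frag_of (ract x s, v) - frag_of (x, s \<odot>\<^bsub>M\<^esub> v)"
    "x \<in> carrier P" "s \<in> carrier R" "v \<in> carrier M"
  then show "left_mult a r \<in> tensor_relations R P ract M"
    using tensor_relationsI(3)[of "a \<odot>\<^bsub>P\<^esub> x" s v] assms(1)
    by (simp add: left_mult_simps P.smult_closed smult_ract)
qed

lemma inv_F: "c \<in> carrier F \<Longrightarrow> inv\<^bsub>F\<^esub> c = - c"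
  by simp

lemma left_mult_K:
  assumes a: "a \<in> carrier S" and k: "k \<in> K"
  shows "left_mult a k \<in> K"
  using k
proof (induction rule: generate.induct)
  case (incl r)
  then show ?case by (intro generate.incl left_mult_tensor_relations a)
next
  case (inv r)
  have "left_mult a r \<in> K" using inv by (intro generate.incl left_mult_tensor_relations a)
  moreover have "left_mult a (- r) = - left_mult a r" using left_mult_simps(2)[of a 0 r] by (simp add: left_mult_simps)
  moreover have "inv\<^bsub>F\<^esub> r = - r" using inv tensor_relations_subset by (intro inv_F) blast
  ultimately show ?case by (simp only: K_closed(4))
qed (simp_all add: left_mult_simps K_closed)

lemma T_smult:
  assumes a: "a \<in> carrier S"
  shows "a \<odot>\<^bsub>T\<^esub> coset c = coset (left_mult a c)"
proof -
  have "(\<lambda>c. coset (left_mult a c)) ` coset c = {coset (left_mult a c)}"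
  proof -
    have "coset (left_mult a (k + c)) = coset (left_mult a c)" if "k \<in> K" for k
      using left_mult_K[OF a that] by (simp add: coset_eq_iff left_mult_simps)
    then show ?thesis using K_closed(1) unfolding coset_eq[of c] by (auto simp: image_image)
  qed
  then show ?thesis
    by (simp add: tensor_product_def Let_def coset_def left_mult_def)
qed

lemma tens_closed [simp]: "x \<in> carrier P \<Longrightarrow> v \<in> carrier M \<Longrightarrow> tens x v \<in> carrier T"
  by (simp add: tens_def carrier_T)

lemma smult_tens: "a \<in> carrier S \<Longrightarrow> a \<odot>\<^bsub>T\<^esub> tens x v = tens (a \<odot>\<^bsub>P\<^esub> x) v"
  by (simp add: tens_def T_smult left_mult_simps)

lemma tens_add_left:
  assumes "x \<in> carrier P" "y \<in> carrier P" "v \<in> carrier M"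
  shows "tens (x \<oplus>\<^bsub>P\<^esub> y) v = tens x v \<oplus>\<^bsub>T\<^esub> tens y v"
  using assms generate.incl[OF tensor_relationsI(1)[OF assms], of F]
  by (simp add: tens_def T_add coset_eq_iff diff_diff_eq)

lemma tens_add_right:
  assumes "x \<in> carrier P" "v \<in> carrier M" "w \<in> carrier M"
  shows "tens x (v \<oplus>\<^bsub>M\<^esub> w) = tens x v \<oplus>\<^bsub>T\<^esub> tens x w"
  using assms generate.incl[OF tensor_relationsI(2)[OF assms], of F]
  by (simp add: tens_def T_add coset_eq_iff diff_diff_eq)

lemma tens_balanced:
  assumes "x \<in> carrier P" "r \<in> carrier R" "v \<in> carrier M"
  shows "tens (ract x r) v = tens x (r \<odot>\<^bsub>M\<^esub> v)"
  using generate.incl[OF tensor_relationsI(3)[OF assms], of F] by (simp add: tens_def coset_eq_iff)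

text \<open>Pure tensors generate: additive inverses are absorbed into the first factor.\<close>

lemma tensor_induct [consumes 1, case_names tens add]:
  assumes "g \<in> carrier T"
    and tens: "\<And>x v. x \<in> carrier P \<Longrightarrow> v \<in> carrier M \<Longrightarrow> Q (tens x v)"
    and add: "\<And>g h. g \<in> carrier T \<Longrightarrow> h \<in> carrier T \<Longrightarrow> Q g \<Longrightarrow> Q h \<Longrightarrow> Q (g \<oplus>\<^bsub>T\<^esub> h)"
  shows "Q g"
proof -
  interpret T: abelian_group T by (rule abelian_group_T)
  have zero_tens: "tens \<zero>\<^bsub>P\<^esub> v = \<zero>\<^bsub>T\<^esub>" if "v \<in> carrier M" for v
    using tens_add_left[of "\<zero>\<^bsub>P\<^esub>" "\<zero>\<^bsub>P\<^esub>" v] that by simp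
  have minus_tens: "\<ominus>\<^bsub>T\<^esub> tens x v = tens (\<ominus>\<^bsub>P\<^esub> x) v" if "x \<in> carrier P" "v \<in> carrier M" for x v
    using tens_add_left[of "\<ominus>\<^bsub>P\<^esub> x" x v] that zero_tens[OF that(2)]
    by (intro T.minus_equality) (simp_all add: P.l_neg)
  have Q_zero: "Q \<zero>\<^bsub>T\<^esub>" using tens[of "\<zero>\<^bsub>P\<^esub>" "\<zero>\<^bsub>M\<^esub>"] zero_tens[of "\<zero>\<^bsub>M\<^esub>"] by simp
  have "Q (coset c) \<and> Q (\<ominus>\<^bsub>T\<^esub> coset c) \<and> c \<in> carrier F" if "Poly_Mapping.keys c \<subseteq> carrier P \<times> carrier M" for c
    using that
  proof (induction rule: frag_induction)
    case zero
    have "\<ominus>\<^bsub>T\<^esub> \<zero>\<^bsub>T\<^esub> = \<zero>\<^bsub>T\<^esub>" by (rule T.minus_equality) simp_all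
    then have "Q (coset 0)" "Q (\<ominus>\<^bsub>T\<^esub> coset 0)" using Q_zero unfolding T_zero by metis+
    then show ?case by simp
  next
    case (diff c d)
    then have cd: "c \<in> carrier F" "d \<in> carrier F" "c - d \<in> carrier F" using F_diff_closed by blast+
    then have carr: "coset c \<in> carrier T" "coset d \<in> carrier T" "coset (c - d) \<in> carrier T" by (simp_all only: carrier_T imageI)
    have "coset (c - d) \<oplus>\<^bsub>T\<^esub> coset d = coset c" using T_add[OF cd(3,2)] by simp
    then have "coset c \<oplus>\<^bsub>T\<^esub> \<ominus>\<^bsub>T\<^esub> coset d = coset (c - d) \<oplus>\<^bsub>T\<^esub> coset d \<oplus>\<^bsub>T\<^esub> \<ominus>\<^bsub>T\<^esub> coset d" by simp
    also have "\<dots> = coset (c - d)" using carr by (simp add: T.a_assoc T.r_neg)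
    finally have eq: "coset (c - d) = coset c \<oplus>\<^bsub>T\<^esub> \<ominus>\<^bsub>T\<^esub> coset d" ..
    moreover have "\<ominus>\<^bsub>T\<^esub> (coset c \<oplus>\<^bsub>T\<^esub> \<ominus>\<^bsub>T\<^esub> coset d) = \<ominus>\<^bsub>T\<^esub> coset c \<oplus>\<^bsub>T\<^esub> coset d"
      using carr by (simp add: T.minus_add)
    ultimately show ?case using diff carr cd by (simp only: add T.a_inv_closed simp_thms)
  next
    case (one z)
    then show ?case using tens minus_tens by (cases z) (auto simp: tens_def)
  qed
  then show ?thesis using assms(1) by (auto simp: carrier_T)
qed

lemma left_module_tensor: "left_module S T"
proof (intro left_module.intro left_module_axioms.intro abelian_group_T)
  show "ring S" by (rule P.R.ring_axioms)
  have repr: "\<exists>c\<in>carrier F. g = coset c" if "g \<in> carrier T" for g using that by (auto simp: carrier_T)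
  interpret T: abelian_group T by (rule abelian_group_T)
  have closed: "a \<odot>\<^bsub>T\<^esub> g \<in> carrier T" if "a \<in> carrier S" "g \<in> carrier T" for a g
    using repr[OF that(2)] that(1) left_mult_closed by (auto simp only: T_smult carrier_T intro: imageI)
  have r_distr: "a \<odot>\<^bsub>T\<^esub> (g \<oplus>\<^bsub>T\<^esub> h) = a \<odot>\<^bsub>T\<^esub> g \<oplus>\<^bsub>T\<^esub> a \<odot>\<^bsub>T\<^esub> h"
    if "a \<in> carrier S" "g \<in> carrier T" "h \<in> carrier T" for a g h
    using repr[OF that(2)] repr[OF that(3)] that(1) left_mult_closed
    by (auto simp only: T_smult T_add left_mult_simps)
  show "\<one>\<^bsub>S\<^esub> \<odot>\<^bsub>T\<^esub> g = g" if "g \<in> carrier T" for g using that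
    by (induction rule: tensor_induct) (simp_all add: smult_tens P.smult_one r_distr)
  fix a g assume a: "a \<in> carrier S" and g: "g \<in> carrier T"
  show "a \<odot>\<^bsub>T\<^esub> g \<in> carrier T" using closed a g .
  show "a \<odot>\<^bsub>T\<^esub> (g \<oplus>\<^bsub>T\<^esub> h) = a \<odot>\<^bsub>T\<^esub> g \<oplus>\<^bsub>T\<^esub> a \<odot>\<^bsub>T\<^esub> h" if "h \<in> carrier T" for h
    using r_distr a g that .
  fix b assume b: "b \<in> carrier S"
  show "(a \<oplus>\<^bsub>S\<^esub> b) \<odot>\<^bsub>T\<^esub> g = a \<odot>\<^bsub>T\<^esub> g \<oplus>\<^bsub>T\<^esub> b \<odot>\<^bsub>T\<^esub> g" using g
  proof (induction rule: tensor_induct)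
    case (tens x v)
    then show ?case using a b by (simp add: smult_tens P.smult_l_distr P.smult_closed tens_add_left)
  next
    case (add g h)
    then show ?case using a b closed by (simp add: r_distr T.a_ac)
  qed
  show "(a \<otimes>\<^bsub>S\<^esub> b) \<odot>\<^bsub>T\<^esub> g = a \<odot>\<^bsub>T\<^esub> (b \<odot>\<^bsub>T\<^esub> g)" using g
    by (induction rule: tensor_induct) (use a b closed in \<open>simp_all add: smult_tens P.smult_assoc r_distr\<close>)
qed

text \<open>
  A biadditive balanced map extends to the free abelian group on pairs and kills the tensor relations,
  hence factors through the quotient.
\<close>

lemma tensor_universal:
  assumes A: "abelian_group A"
    and closed: "\<And>x v. x \<in> carrier P \<Longrightarrow> v \<in> carrier M \<Longrightarrow> b x v \<in> carrier A"
    and left: "\<And>x y v. x \<in> carrier P \<Longrightarrow> y \<in> carrier P \<Longrightarrow> v \<in> carrier M \<Longrightarrow>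
      b (x \<oplus>\<^bsub>P\<^esub> y) v = b x v \<oplus>\<^bsub>A\<^esub> b y v"
    and right: "\<And>x v w. x \<in> carrier P \<Longrightarrow> v \<in> carrier M \<Longrightarrow> w \<in> carrier M \<Longrightarrow>
      b x (v \<oplus>\<^bsub>M\<^esub> w) = b x v \<oplus>\<^bsub>A\<^esub> b x w"
    and balanced: "\<And>x r v. x \<in> carrier P \<Longrightarrow> r \<in> carrier R \<Longrightarrow> v \<in> carrier M \<Longrightarrow>
      b (ract x r) v = b x (r \<odot>\<^bsub>M\<^esub> v)"
  obtains h where "\<And>g. g \<in> carrier T \<Longrightarrow> h g \<in> carrier A"
    "\<And>g g'. g \<in> carrier T \<Longrightarrow> g' \<in> carrier T \<Longrightarrow> h (g \<oplus>\<^bsub>T\<^esub> g') = h g \<oplus>\<^bsub>A\<^esub> h g'"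
    "\<And>x v. x \<in> carrier P \<Longrightarrow> v \<in> carrier M \<Longrightarrow> h (tens x v) = b x v"
proof -
  interpret A: abelian_group A by (rule A)
  have "(\<lambda>(x, v). b x v) ` (carrier P \<times> carrier M) \<subseteq> carrier (add_monoid A)" using closed by auto
  then obtain h where h: "h \<in> hom F (add_monoid A)" "\<And>z. z \<in> carrier P \<times> carrier M \<Longrightarrow> h (frag_of z) = (\<lambda>(x, v). b x v) z"
    using comm_group.free_Abelian_group_universal[OF A.a_comm_group] by blast
  have h_closed: "h c \<in> carrier A" if "c \<in> carrier F" for c using h(1) that by (auto simp: hom_def)
  have h_add: "h (c + d) = h c \<oplus>\<^bsub>A\<^esub> h d" if "c \<in> carrier F" "d \<in> carrier F" for c d
    using h(1) that by (auto simp: hom_def)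
  have h_of: "h (frag_of (x, v)) = b x v" if "x \<in> carrier P" "v \<in> carrier M" for x v
    using h(2)[of "(x, v)"] that by simp
  have h_eq: "h c = h d" if "c - d \<in> carrier F" "d \<in> carrier F" "h (c - d) = \<zero>\<^bsub>A\<^esub>" for c d
    using h_add[OF that(1,2)] that h_closed by simp
  have h_diff: "h (c - d) = \<zero>\<^bsub>A\<^esub>" if "c \<in> carrier F" "d \<in> carrier F" "h c = h d" for c d
  proof -
    have "h (c - d) \<oplus>\<^bsub>A\<^esub> h d = h d" using h_add[of "c - d" d] that F_diff_closed by simp
    then show ?thesis using h_closed that F_diff_closed[OF that(1,2)] by simp
  qed
  have h_rel: "h r = \<zero>\<^bsub>A\<^esub>" if "r \<in> tensor_relations R P ract M" for r
    using that unfolding tensor_relations_def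
  proof (elim UnE CollectE exE conjE)
    fix x y v assume *: "r = frag_of (x \<oplus>\<^bsub>P\<^esub> y, v) - frag_of (x, v) - frag_of (y, v)"
      "x \<in> carrier P" "y \<in> carrier P" "v \<in> carrier M"
    then show ?thesis
      unfolding *(1) diff_diff_eq by (intro h_diff F_add_closed) (simp_all add: h_add h_of left)
  next
    fix x v w assume *: "r = frag_of (x, v \<oplus>\<^bsub>M\<^esub> w) - frag_of (x, v) - frag_of (x, w)"
      "x \<in> carrier P" "v \<in> carrier M" "w \<in> carrier M"
    then show ?thesis
      unfolding *(1) diff_diff_eq by (intro h_diff F_add_closed) (simp_all add: h_add h_of right)
  next
    fix x s v assume *: "r = frag_of (ract x s, v) - frag_of (x, s \<odot>\<^bsub>M\<^esub> v)"
      "x \<in> carrier P" "s \<in> carrier R" "v \<in> carrier M"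
    then show ?thesis
      unfolding *(1) by (intro h_diff) (simp_all add: h_of balanced ract_closed M_smult_closed)
  qed
  have h_K: "h k = \<zero>\<^bsub>A\<^esub>" if "k \<in> K" for k
    using that
  proof (induction rule: generate.induct)
    case one
    then show ?case using h_diff[of 0 0] by simp
  next
    case (incl r)
    then show ?case by (rule h_rel)
  next
    case (inv r)
    have r: "r \<in> carrier F" using inv tensor_relations_subset by blast
    have "inv\<^bsub>F\<^esub> r = 0 - r" using inv_F[OF r] by simp
    moreover have "h r = \<zero>\<^bsub>A\<^esub>" using inv by (rule h_rel)
    ultimately show ?case using h_diff[of 0 r] r h_diff[of 0 0] by simp
  next
    case (eng c d)
    then show ?case using h_add K_closed(3) by simp
  qed
  have "h c = h d" if "c \<in> carrier F" "d \<in> carrier F" "K #>\<^bsub>F\<^esub> c = K #>\<^bsub>F\<^esub> d" for c d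
    using h_K[of "c - d"] that coset_eq_iff[of c d] unfolding coset_def
    by (intro h_eq F_diff_closed) simp_all
  then obtain h' where h': "h' \<in> hom (F Mod K) (add_monoid A)" "\<And>c. c \<in> carrier F \<Longrightarrow> h' (K #>\<^bsub>F\<^esub> c) = h c"
    using FactGroup_universal[OF h(1) normal_K] by metis
  have h'_coset: "h' (coset c) = h c" if "c \<in> carrier F" for c using h'(2)[OF that] by (simp add: coset_def)
  show thesis
  proof (rule that)
    fix g assume "g \<in> carrier T"
    then obtain c where c: "c \<in> carrier F" "g = coset c" by (auto simp only: carrier_T)
    then show "h' g \<in> carrier A" by (simp only: h'_coset h_closed)
    fix g' assume "g' \<in> carrier T"
    then obtain d where d: "d \<in> carrier F" "g' = coset d" by (auto simp only: carrier_T)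
    then show "h' (g \<oplus>\<^bsub>T\<^esub> g') = h' g \<oplus>\<^bsub>A\<^esub> h' g'"
      using c by (simp only: T_add h'_coset F_add_closed h_add)
  next
    fix x v assume "x \<in> carrier P" "v \<in> carrier M"
    then show "h' (tens x v) = b x v" by (simp add: tens_def h'_coset h_of)
  qed
qed

end

section \<open>The universal property of the standard module\<close>

(* The index N + 2 of the algebra has to keep its form, as the facts about it are stated for N + 2. *)
declare add_2_eq_Suc [simp del] add_2_eq_Suc' [simp del]

text \<open>
  A linear map \<open>\<theta>\<close> from the standard module on \<open>N\<close> points to a module over the algebra on \<open>N + 2\<close> points
  that behaves like \<open>w \<mapsto> insert_arcs (N + 1) w\<close>: the generators below \<open>N\<close> pass through, and \<open>e\<^bsub>N+1\<^esub>\<close>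
  closes a loop. The aim is to extend it along \<open>insert_arcs (N + 1)\<close> to a linear map \<open>\<Phi>\<close>. The bound on
  \<open>j\<close> makes sure that every link state on \<open>N + 2\<close> points has an arc.
\<close>

locale arc_closing_map = X: left_module "TL (N + 2) m" X
  for N :: nat and m :: complex and X :: "(free_alg set, 'x, 'e) module_scheme" +
  fixes j :: real and \<theta> :: "(link \<Rightarrow>\<^sub>0 complex) \<Rightarrow> 'x"
  assumes m: "m \<noteq> 0" and j: "j \<le> real N / 2"
    and \<theta>_closed: "w \<in> link_space N j \<Longrightarrow> \<theta> w \<in> carrier X"
    and \<theta>_add: "v \<in> link_space N j \<Longrightarrow> w \<in> link_space N j \<Longrightarrow> \<theta> (v + w) = \<theta> v \<oplus>\<^bsub>X\<^esub> \<theta> w"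
    and \<theta>_scale: "w \<in> link_space N j \<Longrightarrow> \<theta> (scale c w) = tl_class (N + 2) m (scalar c) \<odot>\<^bsub>X\<^esub> \<theta> w"
    and \<theta>_gen: "w \<in> link_space N j \<Longrightarrow> 1 \<le> i \<Longrightarrow> i < N \<Longrightarrow>
      \<theta> (gen_action m i w) = tl_class (N + 2) m (gen i) \<odot>\<^bsub>X\<^esub> \<theta> w"
    and \<theta>_loop: "w \<in> link_space N j \<Longrightarrow>
      \<theta> (scale m w) = tl_class (N + 2) m (gen (N + 1)) \<odot>\<^bsub>X\<^esub> \<theta> w"
begin

abbreviation "A \<equiv> carrier (free_algebra (N + 2))"

definition act :: "free_alg \<Rightarrow> 'x \<Rightarrow> 'x" where
  "act f x = tl_class (N + 2) m f \<odot>\<^bsub>X\<^esub> x"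

abbreviation E :: "nat \<Rightarrow> 'x \<Rightarrow> 'x" where "E i \<equiv> act (gen i)"

lemma act_closed: "f \<in> A \<Longrightarrow> x \<in> carrier X \<Longrightarrow> act f x \<in> carrier X"
  by (simp add: act_def X.smult_closed)

lemma act_add: "f \<in> A \<Longrightarrow> x \<in> carrier X \<Longrightarrow> y \<in> carrier X \<Longrightarrow> act f (x \<oplus>\<^bsub>X\<^esub> y) = act f x \<oplus>\<^bsub>X\<^esub> act f y"
  by (simp add: act_def X.smult_r_distr)

lemma act_plus: "f \<in> A \<Longrightarrow> g \<in> A \<Longrightarrow> x \<in> carrier X \<Longrightarrow> act (f + g) x = act f x \<oplus>\<^bsub>X\<^esub> act g x"
  by (simp add: act_def X.smult_l_distr flip: TL_simps)

lemma act_mult: "f \<in> A \<Longrightarrow> g \<in> A \<Longrightarrow> x \<in> carrier X \<Longrightarrow> act (f * g) x = act f (act g x)"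
  by (simp add: act_def X.smult_assoc flip: TL_simps)

lemma act_one: "x \<in> carrier X \<Longrightarrow> act (scalar 1) x = x"
  using X.smult_one by (simp add: act_def TL_simps one_eq_scalar)

lemma act_cong: "f - g \<in> tl_relations (N + 2) m \<Longrightarrow> act f x = act g x"
  by (simp add: act_def tl_class_eq_iff[THEN iffD2, OF tl_relations_in_ideal])

lemma E_closed: "1 \<le> i \<Longrightarrow> i \<le> N + 1 \<Longrightarrow> x \<in> carrier X \<Longrightarrow> E i x \<in> carrier X"
  by (simp add: act_closed)

lemma act_scalar_scalar: "x \<in> carrier X \<Longrightarrow> act (scalar c) (act (scalar d) x) = act (scalar (c * d)) x"
  by (subst act_mult[symmetric]) (simp_all, simp add: scalar_def)

lemma act_scalar_zero: "x \<in> carrier X \<Longrightarrow> act (scalar 0) x = \<zero>\<^bsub>X\<^esub>"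
  using act_plus[of "scalar 0" "scalar 0" x] act_closed[of "scalar 0" x] by (simp add: scalar_def)

lemma E_scalar:
  assumes "1 \<le> i" "i \<le> N + 1" "x \<in> carrier X"
  shows "E i (act (scalar c) x) = act (scalar c) (E i x)"
proof -
  have "gen i * scalar c = scalar c * gen i"
    by (simp add: gen_def scalar_def mult_single zero_word_def plus_word_def)
  then show ?thesis using assms act_mult[of "gen i" "scalar c" x] act_mult[of "scalar c" "gen i" x] by simp
qed

lemma E_square:
  assumes "1 \<le> i" "i \<le> N + 1" "x \<in> carrier X"
  shows "E i (E i x) = act (scalar m) (E i x)"
proof -
  have "act (gen i * gen i) x = act (scalar m * gen i) x"
    by (intro act_cong tl_relationsI) (use assms in simp_all)
  then show ?thesis using assms act_mult[of "gen i" "gen i" x] act_mult[of "scalar m" "gen i" x] by simp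
qed

lemma E_braid:
  assumes "1 \<le> i" "i \<le> N + 1" "1 \<le> k" "k \<le> N + 1" "k = i + 1 \<or> i = k + 1" "x \<in> carrier X"
  shows "E i (E k (E i x)) = E i x"
proof -
  have "act (gen i * gen k * gen i) x = act (gen i) x"
    by (intro act_cong tl_relationsI) (use assms in simp_all)
  then show ?thesis using assms by (simp add: act_mult act_closed)
qed

lemma E_commute:
  assumes "1 \<le> i" "i \<le> N + 1" "1 \<le> k" "k \<le> N + 1" "i + 1 < k \<or> k + 1 < i" "x \<in> carrier X"
  shows "E i (E k x) = E k (E i x)"
proof -
  have "act (gen i * gen k) x = act (gen k * gen i) x"
    by (intro act_cong tl_relationsI) (use assms in simp_all)
  then show ?thesis using assms by (simp add: act_mult)
qed

text \<open>
  Inserting an arc at \<open>k\<close> equals inserting it at \<open>N + 1\<close> and moving it down by \<open>e\<^sub>k \<dots> e\<^sub>N\<close>, so this is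
  the only possible value of \<open>\<Phi>\<close> on \<open>insert_arcs k w\<close>.
\<close>

definition \<phi> :: "nat \<Rightarrow> (link \<Rightarrow>\<^sub>0 complex) \<Rightarrow> 'x" where
  "\<phi> k w = foldr E [k..<N + 1] (\<theta> w)"

lemma \<phi>_last: "\<phi> (N + 1) w = \<theta> w"
  by (simp add: \<phi>_def)

lemma \<phi>_step: "k \<le> N \<Longrightarrow> \<phi> k w = E k (\<phi> (k + 1) w)"
  unfolding \<phi>_def by (subst upt_conv_Cons) simp_all

lemma position_induct [consumes 2, case_names last step]:
  assumes "1 \<le> k" "k \<le> N + 1" and "Q (N + 1)"
    and "\<And>k. 1 \<le> k \<Longrightarrow> k \<le> N \<Longrightarrow> Q (k + 1) \<Longrightarrow> Q k"
  shows "Q k"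
  using assms(2,1)
proof (induction k rule: inc_induct)
  case (step k)
  then show ?case using assms(4)[of k] by simp
qed (rule assms(3))

lemma \<phi>_closed: "1 \<le> k \<Longrightarrow> k \<le> N + 1 \<Longrightarrow> w \<in> link_space N j \<Longrightarrow> \<phi> k w \<in> carrier X"
proof (induction rule: position_induct)
  case last then show ?case unfolding \<phi>_last by (rule \<theta>_closed)
qed (simp add: \<phi>_step act_closed)

lemma \<phi>_add:
  assumes "1 \<le> k" "k \<le> N + 1" "v \<in> link_space N j" "w \<in> link_space N j"
  shows "\<phi> k (v + w) = \<phi> k v \<oplus>\<^bsub>X\<^esub> \<phi> k w"
  using assms(1,2)
proof (induction rule: position_induct)
  case last then show ?case unfolding \<phi>_last by (intro \<theta>_add assms)
next
  case (step k)
  then show ?case using \<phi>_closed[of "k + 1"] assms(3,4) by (simp add: \<phi>_step act_add)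
qed

lemma \<phi>_scale:
  assumes "1 \<le> k" "k \<le> N + 1" "w \<in> link_space N j"
  shows "\<phi> k (scale c w) = act (scalar c) (\<phi> k w)"
  using assms(1,2)
proof (induction rule: position_induct)
  case last then show ?case unfolding \<phi>_last act_def by (intro \<theta>_scale assms)
next
  case (step k)
  then show ?case using \<phi>_closed[of "k + 1" w] assms(3) by (simp add: \<phi>_step E_scalar)
qed

lemma E_\<phi>_same:
  assumes "1 \<le> k" "k \<le> N + 1" "w \<in> link_space N j"
  shows "E k (\<phi> k w) = act (scalar m) (\<phi> k w)"
proof (cases "k = N + 1")
  case True
  then show ?thesis using \<theta>_loop[OF assms(3)] \<theta>_scale[OF assms(3), of m] \<phi>_last by (simp add: act_def)
next
  case False
  then show ?thesis using assms \<phi>_closed[of "k + 1" w] by (simp add: \<phi>_step E_square)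
qed

text \<open>Since \<open>m \<noteq> 0\<close>, the vector \<open>\<phi> (k + 1) w\<close> is itself an image under \<open>E (k + 1)\<close>, so the
  braid-like relation applies even at the last position.\<close>

lemma E_\<phi>_right:
  assumes "1 \<le> k" "k \<le> N" "w \<in> link_space N j"
  shows "E (k + 1) (\<phi> k w) = \<phi> (k + 1) w"
proof -
  let ?y = "\<phi> (k + 1) w"
  have y: "?y \<in> carrier X" using \<phi>_closed assms by simp
  have "?y = act (scalar (1 / m)) (act (scalar m) ?y)"
    using y m by (simp add: act_scalar_scalar act_one)
  also have "\<dots> = act (scalar (1 / m)) (E (k + 1) ?y)"
    using E_\<phi>_same[of "k + 1" w] assms by simp
  finally have eq: "act (scalar (1 / m)) (E (k + 1) ?y) = ?y" ..
  have "E (k + 1) (\<phi> k w) = E (k + 1) (E k (act (scalar (1 / m)) (E (k + 1) ?y)))"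
    using assms by (simp only: eq \<phi>_step)
  also have "\<dots> = act (scalar (1 / m)) (E (k + 1) (E k (E (k + 1) ?y)))"
    using assms y by (simp add: E_scalar act_closed)
  also have "\<dots> = ?y"
    using assms y by (simp add: E_braid[simplified] eq[simplified])
  finally show ?thesis .
qed

text \<open>
  A generator below the neighbour of \<open>e\<^sub>k\<close> commutes with all of \<open>e\<^sub>k \<dots> e\<^sub>N\<close> and reaches \<open>\<theta>\<close> unchanged.
\<close>

lemma E_\<phi>_before:
  assumes k: "1 \<le> k" "k \<le> N + 1" and w: "w \<in> link_space N j"
  shows "1 \<le> i \<Longrightarrow> i + 1 < k \<Longrightarrow> E i (\<phi> k w) = \<phi> k (gen_action m i w)"
  using k
proof (induction rule: position_induct)
  case last
  then show ?case using \<theta>_gen[OF w, of i] unfolding \<phi>_last by (simp add: act_def)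
next
  case (step k)
  then show ?case using \<phi>_closed[of "k + 1" w] w E_commute[of i k "\<phi> (k + 1) w"] by (simp add: \<phi>_step)
qed

text \<open>
  A generator above \<open>k\<close> meets \<open>e\<^sub>i e\<^bsub>i+1\<^esub>\<close> inside \<open>e\<^sub>k \<dots> e\<^sub>N\<close> and comes out on the right with its index
  lowered by two, because \<open>e\<^bsub>i+2\<^esub> e\<^sub>i e\<^bsub>i+1\<^esub> e\<^bsub>i+2\<^esub> = e\<^sub>i e\<^bsub>i+2\<^esub> = e\<^sub>i e\<^bsub>i+1\<^esub> e\<^sub>i e\<^bsub>i+2\<^esub>\<close>; at the
  upper end the missing \<open>e\<^bsub>N+1\<^esub>\<close> is supplied by \<open>\<theta>_loop\<close>.
\<close>

lemma E_\<phi>_after: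
  assumes "1 \<le> k" "k \<le> i" "i < N" and w: "w \<in> link_space N j"
  shows "E (i + 2) (\<phi> k w) = \<phi> k (gen_action m i w)"
  using assms(2,1)
proof (induction k rule: inc_induct)
  case base
  have i: "1 \<le> i" "i + 2 \<le> N + 1" using base assms by auto
  let ?y = "\<phi> (i + 2) w"
  have y: "?y \<in> carrier X" "\<phi> (i + 1) w \<in> carrier X" using \<phi>_closed[OF _ _ w] i by auto
  have "E (i + 2) (\<phi> i w) = E i (E (i + 2) (\<phi> (i + 1) w))"
    using E_commute[of i "i + 2" "\<phi> (i + 1) w"] i y by (simp add: \<phi>_step)
  also have "\<dots> = E i ?y" using E_\<phi>_right[of "i + 1" w] i w by (simp add: add_2_eq_Suc')
  also have "\<dots> = E i (E (i + 1) (E i ?y))"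
    using E_braid[of i "i + 1" ?y] i y by simp
  also have "\<dots> = E i (E (i + 1) (\<phi> (i + 2) (gen_action m i w)))"
    using E_\<phi>_before[of "i + 2" w i] i w by simp
  also have "\<dots> = \<phi> i (gen_action m i w)"
    using i by (simp add: \<phi>_step add_2_eq_Suc')
  finally show ?case .
next
  case (step k)
  then show ?case using \<phi>_closed[of "k + 1" w] w E_commute[of "i + 2" k "\<phi> (k + 1) w"] assms(3)
    by (simp add: \<phi>_step)
qed

lemma E_\<phi>_far:
  assumes "1 \<le> k" "k \<le> N + 1" "1 \<le> i" "i < N" "i + 1 < k \<or> k \<le> i" "w \<in> link_space N j"
  shows "E (skip k i) (\<phi> k w) = \<phi> k (gen_action m i w)"
  using assms E_\<phi>_before[of k w i] E_\<phi>_after[of k i w] by (auto simp: skip_def)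

text \<open>
  The value on a link state must not depend on which of its small arcs is removed. The two sides remove
  the lower and the upper one of two small arcs. Moving the lower arc up with the relations for
  neighbouring arcs reduces this to adjacent arcs \<open>k = l\<close>. There both sides agree after applying \<open>e\<^sub>l\<close> to
  \<open>insert_arcs l u\<close>, which multiplies by \<open>m \<noteq> 0\<close>.
\<close>

lemma \<phi>_two_arcs:
  assumes "k \<le> l" "1 \<le> k" "l + 1 \<le> N" "u \<in> link_space (N - 2) j"
  shows "\<phi> k (insert_arcs l u) = \<phi> (l + 2) (insert_arcs k u)"
  using assms(1,2)
proof (induction k rule: inc_induct)
  case base
  have N: "N = (N - 2) + 2" using base assms by simp
  define w where "w = insert_arcs l u"
  have w: "w \<in> link_space N j"
    using insert_arcs_closed[OF assms(4), of l] base assms(3) N unfolding w_def by (metis add_le_cancel_right add.assoc nat_1_add_1 one_add_one)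
  have l: "1 \<le> l" "l + 2 \<le> N + 1" using base assms by auto
  have y: "\<phi> (l + 1) w \<in> carrier X" "\<phi> (l + 2) w \<in> carrier X" "\<phi> l w \<in> carrier X" using \<phi>_closed[OF _ _ w] l by auto
  have "act (scalar m) (\<phi> l w) = \<phi> l (gen_action m l w)"
    using \<phi>_scale[of l w m] w l by (simp add: w_def gen_action_insert_arcs_same)
  also have "\<dots> = E (l + 2) (\<phi> l w)" using E_\<phi>_after[of l l w] l w by simp
  also have "\<dots> = E l (E (l + 2) (\<phi> (l + 1) w))"
    using E_commute[of l "l + 2" "\<phi> (l + 1) w"] l y by (simp add: \<phi>_step)
  also have "\<dots> = E l (\<phi> (l + 2) w)" using E_\<phi>_right[of "l + 1" w] l w by (simp add: add_2_eq_Suc')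
  also have "\<dots> = \<phi> (l + 2) (gen_action m l w)" using E_\<phi>_before[of "l + 2" w l] l w by simp
  also have "\<dots> = act (scalar m) (\<phi> (l + 2) w)"
    using \<phi>_scale[of "l + 2" w m] w l by (simp add: w_def gen_action_insert_arcs_same)
  finally have "act (scalar (1 / m)) (act (scalar m) (\<phi> l w)) = act (scalar (1 / m)) (act (scalar m) (\<phi> (l + 2) w))"
    by simp
  then show ?case using y m by (simp add: act_scalar_scalar act_one w_def)
next
  case (step k)
  have N: "N = (N - 2) + 2" using step assms by simp
  have ins: "insert_arcs a u \<in> link_space N j" if "1 \<le> a" "a + 1 \<le> N" for a
    using insert_arcs_closed[OF assms(4) that(1)] that(2) N by simp
  have "\<phi> k (insert_arcs l u) = E k (\<phi> (k + 1) (insert_arcs l u))"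
    using step assms by (simp add: \<phi>_step)
  also have "\<dots> = E k (\<phi> (l + 2) (insert_arcs (k + 1) u))" using step by simp
  also have "\<dots> = \<phi> (l + 2) (gen_action m k (insert_arcs (k + 1) u))"
    using E_\<phi>_before[of "l + 2" "insert_arcs (k + 1) u" k] ins[of "k + 1"] step assms by simp
  also have "gen_action m k (insert_arcs (k + 1) u) = insert_arcs k u"
    by (rule gen_action_insert_arcs_left[OF assms(4)])
  finally show ?case .
qed

text \<open>
  Some small arc is removed; by \<open>\<phi>_arc_independent\<close> the choice does not matter.
\<close>

definition \<Phi>\<^sub>0 :: "link \<Rightarrow> 'x" where
  "\<Phi>\<^sub>0 P = (let k = (SOME k. P k = k + 1) in \<phi> k (Poly_Mapping.single (delete_arc k P) 1))"

lemma \<phi>_arc_independent: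
  assumes p: "p \<in> link_states N j" and k: "1 \<le> k" "k \<le> N + 1" and l: "insert_arc k p l = l + 1"
  shows "\<phi> l (Poly_Mapping.single (delete_arc l (insert_arc k p)) 1) = \<phi> k (Poly_Mapping.single p 1)"
proof -
  define P where "P = insert_arc k p"
  have Pk: "P k = k + 1" "P (k + 1) = k" by (simp_all add: P_def)
  have Pl: "P l = l + 1" "P (l + 1) = l"
    using l link_states_involution[OF insert_arc_in_link_states[OF p k], of l] by (simp_all add: P_def)
  have "l \<noteq> k + 1" using Pk(2) Pl(1) by auto
  moreover have "k \<noteq> l + 1" using Pk(1) Pl(2) by auto
  ultimately consider "l = k" | l' where "l = l' + 2" "k \<le> l'" | k' where "k = k' + 2" "l \<le> k'"
    by (metis add.commute add_2_eq_Suc le_Suc_ex less_imp_Suc_add linorder_neqE_nat Suc_eq_plus1 add_Suc_right le_add1 not_less_eq_eq)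
  then show ?thesis
  proof cases
    case 1 then show ?thesis by simp
  next
    case 2
    have "skip k (p l') = skip k (l' + 1)"
      using l 2 insert_arc_simps(3)[of k p l'] by (simp add: skip_def)
    then have p_l: "p l' = l' + 1" by simp
    have bounds: "1 \<le> l'" "l' + 1 \<le> N" using link_states_arc_bounds[OF p p_l] by auto
    then obtain M where M: "N = M + 2" using that[of "N - 2"] by simp
    define q where "q = delete_arc l' p"
    have q: "q \<in> link_states M j" "p = insert_arc l' q"
      using delete_arc_in_link_states[of p M j l'] p p_l by (auto simp: M q_def)
    have "P = insert_arc (l' + 2) (insert_arc k q)"
      using insert_arc_commute[OF 2(2)] by (simp add: P_def q(2))
    then have "delete_arc l P = insert_arc k q" using 2 by simp
    then show ?thesis
      using \<phi>_two_arcs[of k l' "Poly_Mapping.single q 1"] 2 k q bounds by (simp add: M P_def)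
  next
    case 3
    have "skip k (p l) = skip k (l + 1)"
      using l 3 insert_arc_simps(3)[of k p l] by (simp add: skip_def)
    then have p_l: "p l = l + 1" by simp
    have bounds: "1 \<le> l" "l + 1 \<le> N" using link_states_arc_bounds[OF p p_l] by auto
    then obtain M where M: "N = M + 2" using that[of "N - 2"] by simp
    define q where "q = delete_arc l p"
    have q: "q \<in> link_states M j" "p = insert_arc l q"
      using delete_arc_in_link_states[of p M j l] p p_l by (auto simp: M q_def)
    have "P = insert_arc l (insert_arc k' q)"
      using insert_arc_commute[OF 3(2)] by (simp add: P_def q(2) 3(1))
    then have "delete_arc l P = insert_arc k' q" by simp
    then show ?thesis
      using \<phi>_two_arcs[of l k' "Poly_Mapping.single q 1"] 3 k q bounds by (simp add: M P_def)
  qed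
qed

lemma \<Phi>\<^sub>0_insert_arc:
  assumes "p \<in> link_states N j" "1 \<le> k" "k \<le> N + 1"
  shows "\<Phi>\<^sub>0 (insert_arc k p) = \<phi> k (Poly_Mapping.single p 1)"
proof -
  have "insert_arc k p k = k + 1" by simp
  then have "insert_arc k p (SOME l. insert_arc k p l = l + 1) = (SOME l. insert_arc k p l = l + 1) + 1"
    by (rule someI)
  then show ?thesis
    unfolding \<Phi>\<^sub>0_def Let_def by (rule \<phi>_arc_independent[OF assms])
qed

lemma link_state_has_arc:
  assumes "P \<in> link_states (N + 2) j"
  obtains k p where "1 \<le> k" "k \<le> N + 1" "p \<in> link_states N j" "P = insert_arc k p"
  using assms
proof (cases rule: link_states_cases)
  case 1
  then have "through_lines (N + 2) P = {1..N + 2}" by (auto simp: through_lines_def)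
  then have "card (through_lines (N + 2) P) = N + 2" by simp
  then show ?thesis using assms j by (simp add: link_states_def)
next
  case (2 M k p)
  then show ?thesis by (intro that[of k p]) auto
qed

lemma \<Phi>\<^sub>0_closed: "P \<in> link_states (N + 2) j \<Longrightarrow> \<Phi>\<^sub>0 P \<in> carrier X"
  by (erule link_state_has_arc) (simp add: \<Phi>\<^sub>0_insert_arc \<phi>_closed)

definition \<Phi> :: "(link \<Rightarrow>\<^sub>0 complex) \<Rightarrow> 'x" where
  "\<Phi> v = finsum X (\<lambda>P. act (scalar (Poly_Mapping.lookup v P)) (\<Phi>\<^sub>0 P)) (link_states (N + 2) j)"

lemma \<Phi>_closed: "\<Phi> v \<in> carrier X"
  unfolding \<Phi>_def by (intro X.M.finsum_closed) (auto intro!: act_closed \<Phi>\<^sub>0_closed)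

lemma scalar_add: "scalar (c + d) = scalar c + scalar d"
  by (simp add: scalar_def single_add)

lemma \<Phi>_add: "\<Phi> (v + w) = \<Phi> v \<oplus>\<^bsub>X\<^esub> \<Phi> w"
proof -
  have "\<Phi> (v + w) = finsum X (\<lambda>P. act (scalar (Poly_Mapping.lookup v P)) (\<Phi>\<^sub>0 P)
      \<oplus>\<^bsub>X\<^esub> act (scalar (Poly_Mapping.lookup w P)) (\<Phi>\<^sub>0 P)) (link_states (N + 2) j)"
    unfolding \<Phi>_def
    by (intro X.M.finsum_cong') (auto simp: lookup_add scalar_add act_plus \<Phi>\<^sub>0_closed intro!: X.M.a_closed act_closed)
  also have "\<dots> = \<Phi> v \<oplus>\<^bsub>X\<^esub> \<Phi> w"
    unfolding \<Phi>_def by (intro X.M.finsum_addf) (auto intro!: act_closed \<Phi>\<^sub>0_closed)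
  finally show ?thesis .
qed

lemma \<Phi>_zero: "\<Phi> 0 = \<zero>\<^bsub>X\<^esub>"
  using \<Phi>_add[of 0 0] \<Phi>_closed[of 0] by simp

lemma \<Phi>_single:
  assumes "P \<in> link_states (N + 2) j"
  shows "\<Phi> (Poly_Mapping.single P c) = act (scalar c) (\<Phi>\<^sub>0 P)"
proof -
  have "\<Phi> (Poly_Mapping.single P c) = finsum X (\<lambda>Q. if P = Q then act (scalar c) (\<Phi>\<^sub>0 Q) else \<zero>\<^bsub>X\<^esub>) (link_states (N + 2) j)"
    unfolding \<Phi>_def
    by (intro X.M.finsum_cong') (auto simp: lookup_single act_scalar_zero \<Phi>\<^sub>0_closed intro!: act_closed)
  also have "\<dots> = act (scalar c) (\<Phi>\<^sub>0 P)"
    using assms finite_link_states by (intro X.M.finsum_singleton) (auto intro!: act_closed \<Phi>\<^sub>0_closed)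
  finally show ?thesis .
qed

lemma \<Phi>_insert_arcs:
  assumes w: "w \<in> link_space N j" and k: "1 \<le> k" "k \<le> N + 1"
  shows "\<Phi> (insert_arcs k w) = \<phi> k w"
proof -
  have "Poly_Mapping.keys w \<subseteq> link_states N j" using w by simp
  then show ?thesis
  proof (induction rule: poly_mapping_span_induct)
    case zero
    have "\<phi> k 0 = \<phi> k 0 \<oplus>\<^bsub>X\<^esub> \<phi> k 0" using \<phi>_add[OF k, of 0 0] by simp
    then show ?case using \<phi>_closed[OF k, of 0] by (simp add: lin_simps \<Phi>_zero)
  next
    case (single p c)
    then have "\<phi> k (scale c (Poly_Mapping.single p 1)) = act (scalar c) (\<phi> k (Poly_Mapping.single p 1))"
      by (intro \<phi>_scale k) simp
    then show ?case using single k by (simp add: \<Phi>_single insert_arc_in_link_states \<Phi>\<^sub>0_insert_arc)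
  next
    case (add v w)
    then show ?case using \<phi>_add[OF k, of v w] by (simp add: lin_simps \<Phi>_add)
  qed
qed

text \<open>
  The vectors \<open>\<phi> k w\<close> and the combinations \<open>insert_arcs k w\<close> obey the same rules under the generators in
  each of the four relative positions of generator and arc.
\<close>

lemma \<Phi>_gen:
  assumes v: "v \<in> link_space (N + 2) j" and i: "1 \<le> i" "i \<le> N + 1"
  shows "\<Phi> (gen_action m i v) = E i (\<Phi> v)"
proof -
  have "Poly_Mapping.keys v \<subseteq> link_states (N + 2) j" using v by simp
  then show ?thesis
  proof (induction rule: poly_mapping_span_induct)
    case zero
    have "E i \<zero>\<^bsub>X\<^esub> = E i \<zero>\<^bsub>X\<^esub> \<oplus>\<^bsub>X\<^esub> E i \<zero>\<^bsub>X\<^esub>" using act_add[of "gen i" "\<zero>\<^bsub>X\<^esub>" "\<zero>\<^bsub>X\<^esub>"] i by simp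
    then show ?case using E_closed[OF i, of "\<zero>\<^bsub>X\<^esub>"] by (simp add: lin_simps \<Phi>_zero)
  next
    case (single P c)
    then obtain k p where k: "1 \<le> k" "k \<le> N + 1" and p: "p \<in> link_states N j" and P: "P = insert_arc k p"
      by (rule link_state_has_arc)
    define w where "w = Poly_Mapping.single p c"
    have w: "w \<in> link_space N j" using p by (auto simp: w_def)
    have "\<Phi> (gen_action m i (insert_arcs k w)) = E i (\<phi> k w)"
      using i k
    proof (cases rule: generator_position_cases)
      case same
      have "\<Phi> (insert_arcs k (scale m w)) = act (scalar m) (\<phi> k w)"
        using \<Phi>_insert_arcs[of "scale m w" k] \<phi>_scale[OF k w] link_space_closed(3)[OF w] k by simp
      then show ?thesis using E_\<phi>_same[OF k w] by (simp add: same gen_action_insert_arcs_same lin_simps)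
    next
      case right
      then show ?thesis
        using gen_action_insert_arcs_right[OF w, of m k] \<Phi>_insert_arcs[OF w, of "k + 1"] E_\<phi>_right[of k w] w k i by simp
    next
      case left
      then show ?thesis
        using gen_action_insert_arcs_left[OF w, of m i] \<Phi>_insert_arcs[OF w, of i] \<phi>_step[of i w] k i by simp
    next
      case (far i')
      then show ?thesis
        using gen_action_insert_arcs_far[OF far(2), of m w] \<Phi>_insert_arcs[of "gen_action m i' w" k]
          gen_action_closed[OF w far(3,4), of m] E_\<phi>_far[OF k far(3,4,2) w] k by simp
    qed
    then show ?case using \<Phi>_insert_arcs[OF w k] by (simp add: w_def P)
  next
    case (add v w)
    then show ?case using i by (simp add: lin_simps \<Phi>_add act_add \<Phi>_closed)
  qed
qed

lemma \<Phi>_scale: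
  assumes "v \<in> link_space (N + 2) j"
  shows "\<Phi> (scale c v) = act (scalar c) (\<Phi> v)"
proof -
  have "Poly_Mapping.keys v \<subseteq> link_states (N + 2) j" using assms by simp
  then show ?thesis
  proof (induction rule: poly_mapping_span_induct)
    case zero
    have "act (scalar c) \<zero>\<^bsub>X\<^esub> = \<zero>\<^bsub>X\<^esub>"
      using act_add[of "scalar c" "\<zero>\<^bsub>X\<^esub>" "\<zero>\<^bsub>X\<^esub>"] act_closed[of "scalar c" "\<zero>\<^bsub>X\<^esub>"] by simp
    then show ?case by (simp add: \<Phi>_zero)
  next
    case (single P d)
    then show ?case by (simp add: \<Phi>_single act_scalar_scalar \<Phi>\<^sub>0_closed)
  next
    case (add v w)
    then show ?case by (simp add: scale_add \<Phi>_add act_add \<Phi>_closed)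
  qed
qed

theorem \<Phi>_linear:
  assumes "a \<in> carrier (TL (N + 2) m)" and v: "v \<in> link_space (N + 2) j"
  shows "\<Phi> (a \<odot>\<^bsub>standard_module (N + 2) m j\<^esub> v) = a \<odot>\<^bsub>X\<^esub> \<Phi> v"
proof -
  from assms(1) obtain f where f: "f \<in> A" "a = tl_class (N + 2) m f" by (rule TL_cases)
  from f(1) have "\<Phi> (tl_action m f v) = act f (\<Phi> v)"
  proof (induction rule: free_algebra_induct)
    case (scalar c)
    show ?case using \<Phi>_scale[OF v] by simp
  next
    case (add f g)
    then show ?case by (simp add: extend_action_simps \<Phi>_add act_plus \<Phi>_closed)
  next
    case (gen i f)
    then show ?case using \<Phi>_gen[OF tl_action_closed[OF gen(3) v], of i]
      by (simp add: extend_action_mult[OF linear_op_gen_action] act_mult \<Phi>_closed)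
  qed
  then show ?thesis using f standard_module_smult[OF f(1) v, of m] by (simp add: act_def)
qed

end

section \<open>The corner of the Temperley--Lieb algebra\<close>

lemma mult_scale: "f * scale c h = scale c (f * h)" and scale_mult: "scale c f * h = scale c (f * h)"
  for f h :: free_alg
proof -
  show 2: "scale c f * h = scale c (f * h)" for f
    unfolding scalar_mult[symmetric] by (simp only: mult.assoc)
  have "Poly_Mapping.keys f \<subseteq> UNIV" by simp
  then have "f * scalar c = scalar c * f"
  proof (induction rule: poly_mapping_span_induct)
    case (single p d)
    then show ?case by (simp add: scalar_def mult_single zero_word_def plus_word_def mult.commute)
  qed (simp_all add: algebra_simps scale_add)
  then show "f * scale c h = scale c (f * h)"
    unfolding scalar_mult[symmetric] by (simp only: mult.assoc[symmetric])
qed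

text \<open>
  The corner is cut out by \<open>e = idem N m\<close>, which is idempotent because \<open>m \<noteq> 0\<close> and commutes with the
  generators below \<open>N\<close>.
\<close>

locale corner =
  fixes N :: nat and m :: complex
  assumes m: "m \<noteq> 0"
begin

abbreviation "A \<equiv> carrier (free_algebra (N + 2))"
abbreviation "cls \<equiv> tl_class (N + 2) m"
abbreviation "e \<equiv> idem N m"
abbreviation "T' \<equiv> TL (N + 2) m"

sublocale T': ring T' by (rule ring_TL)

definition corner_gen :: "nat \<Rightarrow> free_alg \<Rightarrow> free_alg" where
  "corner_gen i h = e * gen i * e * h"

lemma cls_mult: "f \<in> A \<Longrightarrow> g \<in> A \<Longrightarrow> cls (f * g) = cls f \<otimes>\<^bsub>T'\<^esub> cls g"
  by (simp add: TL_simps)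

lemma cls_mult_cong: "f \<in> A \<Longrightarrow> g \<in> A \<Longrightarrow> h \<in> A \<Longrightarrow> cls g = cls h \<Longrightarrow> cls (f * g) = cls (f * h)"
  by (simp add: cls_mult)

lemma cls_scale_cong: "g \<in> A \<Longrightarrow> h \<in> A \<Longrightarrow> cls g = cls h \<Longrightarrow> cls (scale c g) = cls (scale c h)"
  using cls_mult_cong[of "scalar c" g h] by simp

lemma idem_eq: "e = scale (1 / m) (gen (N + 1))"
  by (simp add: idem_def)

lemma idem_closed [simp]: "e \<in> A"
  by (simp add: idem_eq)

lemma cls_gen_square: "1 \<le> i \<Longrightarrow> i \<le> N + 1 \<Longrightarrow> cls (gen i * gen i) = cls (scale m (gen i))"
  using tl_relations_in_ideal[OF tl_relationsI(1)[of i "N + 2" m]] by (simp add: tl_class_eq_iff)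

lemma gen_idem: "cls (gen (N + 1) * e) = cls (scale m e)"
  using cls_scale_cong[OF _ _ cls_gen_square[of "N + 1"], of "1 / m"] m by (simp add: idem_eq mult_scale)

lemma idem_idem: "cls (e * e) = cls e"
proof -
  have "cls (e * e) = cls (scale (1 / m) (gen (N + 1) * e))" by (simp add: idem_eq scale_mult)
  also have "\<dots> = cls (scale (1 / m) (scale m e))" by (rule cls_scale_cong) (simp_all add: gen_idem[simplified])
  finally show ?thesis using m by simp
qed

lemma idem_commute:
  assumes "1 \<le> i" "i < N"
  shows "cls (e * gen i) = cls (gen i * e)"
proof -
  have "cls (gen (N + 1) * gen i) = cls (gen i * gen (N + 1))"
    using tl_relations_in_ideal[OF tl_relationsI(3)[of "N + 1" "N + 2" i m]] assms by (simp add: tl_class_eq_iff)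
  then have "cls (scale (1 / m) (gen (N + 1) * gen i)) = cls (scale (1 / m) (gen i * gen (N + 1)))"
    by (rule cls_scale_cong[rotated 2]) (use assms in simp_all)
  then show ?thesis by (simp add: idem_eq scale_mult mult_scale)
qed

lemma idem_commute_mult:
  assumes "1 \<le> i" "i < N" "h \<in> A"
  shows "cls (e * (gen i * h)) = cls (gen i * (e * h))"
  using idem_commute[OF assms(1,2)] assms
  by (simp add: cls_mult T'.m_assoc[symmetric])

lemma idem_idem_mult: "h \<in> A \<Longrightarrow> cls (e * (e * h)) = cls (e * h)"
  using idem_idem by (simp add: cls_mult T'.m_assoc[symmetric])

lemma linear_op_corner_gen: "linear_op (corner_gen i)"
  by (simp add: linear_op_def corner_gen_def distrib_left mult_scale)

text \<open>
  The two idempotents in \<open>e e\<^sub>i e h\<close> commute with \<open>e\<^sub>i\<close> and are then absorbed by \<open>h\<close>.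
\<close>

lemma corner_gen:
  assumes i: "1 \<le> i" "i < N" and h: "h \<in> A" "cls (e * h) = cls h"
  shows "corner_gen i h \<in> A" "cls (corner_gen i h) = cls (gen i * h)" "cls (e * corner_gen i h) = cls (corner_gen i h)"
proof -
  show closed: "corner_gen i h \<in> A" using i h by (simp add: corner_gen_def)
  have "cls (corner_gen i h) = cls (e * (gen i * (e * h)))" by (simp add: corner_gen_def mult.assoc)
  also have "\<dots> = cls (gen i * (e * (e * h)))" using i h by (intro idem_commute_mult) simp_all
  also have "\<dots> = cls (gen i * h)"
    using i h idem_idem_mult[of h] by (intro cls_mult_cong) simp_all
  finally show "cls (corner_gen i h) = cls (gen i * h)" .
  show "cls (e * corner_gen i h) = cls (corner_gen i h)"
    using idem_idem_mult[of "gen i * (e * h)"] i h by (simp add: corner_gen_def mult.assoc)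
qed

definition corner_lift :: "free_alg \<Rightarrow> free_alg" where
  "corner_lift f = extend_action corner_gen f e"

text \<open>
  The substitution \<open>e\<^sub>i \<mapsto> e e\<^sub>i e\<close> respects the relations, since modulo the ideal it is multiplication by
  \<open>e\<^sub>i\<close> on the elements fixed by the idempotent. Hence the corner map is well defined.
\<close>

lemma corner_lift_ideal:
  assumes "f \<in> tl_ideal N m"
  shows "corner_lift f \<in> tl_ideal (N + 2) m"
  unfolding corner_lift_def
proof (rule extend_action_tl_ideal[where g = corner_gen and N = N and m = m and f = f and v = e
      and V = "{h \<in> A. cls (e * h) = cls h}" and Z = "tl_ideal (N + 2) m"])
  have mult_e: "cls (e * h) = e' \<otimes>\<^bsub>T'\<^esub> cls h" if "h \<in> A" "e' = cls e" for h e' using that by (simp add: cls_mult)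
  let ?V = "{h \<in> A. cls (e * h) = cls h}"
  note ideal = tl_ideal_closed[where N = "N + 2" and m = m]
  show "v + w \<in> ?V" if "v \<in> ?V" "w \<in> ?V" for v w
    using that by (simp add: distrib_left TL_simps(2)[symmetric])
  show "scale c v \<in> ?V" if "v \<in> ?V" for c v
    using that cls_scale_cong[of "e * v" v c] by (simp add: mult_scale)
  show "corner_gen i v \<in> ?V" if "1 \<le> i" "i < N" "v \<in> ?V" for i v
    using corner_gen[OF that(1,2)] that(3) by simp
  show "0 \<in> tl_ideal (N + 2) m" by (rule ideal)
  show "v + w \<in> tl_ideal (N + 2) m" if "v \<in> tl_ideal (N + 2) m" "w \<in> tl_ideal (N + 2) m" for v w
    using that by (rule ideal)
  show "scale c v \<in> tl_ideal (N + 2) m" if "v \<in> tl_ideal (N + 2) m" for c v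
    using ideal(6)[OF that, of "scalar c"] by simp
  show "corner_gen i v \<in> tl_ideal (N + 2) m" if "1 \<le> i" "i < N" "v \<in> tl_ideal (N + 2) m" for i v
    unfolding corner_gen_def using that by (intro ideal(6)) simp_all
  fix i v assume i: "1 \<le> i" "i < N" and v: "v \<in> ?V"
  have v': "v \<in> A" "cls (e * v) = cls v" using v by auto
  have word: "cls (corner_gen a (corner_gen b v)) = cls (gen a * gen b * v)" if "1 \<le> a" "a < N" "1 \<le> b" "b < N" for a b
    using corner_gen[OF that(1,2)] corner_gen[OF that(3,4)] that v' by (simp add: cls_mult T'.m_assoc)
  have "cls (gen i * gen i * v) = cls (scale m (gen i) * v)"
    using cls_gen_square[of i] i v' by (simp add: cls_mult)
  moreover have "cls (scale m (corner_gen i v)) = cls (scale m (gen i * v))"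
    using corner_gen[OF i v'] i v' by (intro cls_scale_cong) simp_all
  ultimately show "corner_gen i (corner_gen i v) - scale m (corner_gen i v) \<in> tl_ideal (N + 2) m"
    using word[of i i] i by (simp add: tl_class_eq_iff[symmetric] scale_mult)
  fix k assume k: "1 \<le> k" "k < N"
  show "corner_gen i (corner_gen k (corner_gen i v)) - corner_gen i v \<in> tl_ideal (N + 2) m" if ik: "k = i + 1 \<or> i = k + 1"
  proof -
    have "gen i * gen k * gen i - gen i \<in> tl_ideal (N + 2) m"
      by (rule tl_relations_in_ideal[OF tl_relationsI(2)]) (use i k ik in auto)
    then have "cls (gen i * gen k * gen i) = cls (gen i)" by (simp add: tl_class_eq_iff)
    then have "cls (gen i * gen k * gen i * v) = cls (gen i * v)"
      using i k v' by (subst (1 2) cls_mult) simp_all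
    moreover have "cls (corner_gen i (corner_gen k (corner_gen i v))) = cls (gen i * (gen k * (gen i * v)))"
    proof -
      have 1: "corner_gen i v \<in> A" "cls (e * corner_gen i v) = cls (corner_gen i v)" using corner_gen[OF i v'] by auto
      have 2: "corner_gen k (corner_gen i v) \<in> A" "cls (e * corner_gen k (corner_gen i v)) = cls (corner_gen k (corner_gen i v))"
        using corner_gen[OF k 1] by auto
      have "cls (corner_gen i (corner_gen k (corner_gen i v))) = cls (gen i * corner_gen k (corner_gen i v))"
        by (rule corner_gen(2)[OF i 2])
      also have "\<dots> = cls (gen i * (gen k * (gen i * v)))"
        using word[OF k i] i k v' 2 by (intro cls_mult_cong) (simp_all add: mult.assoc)
      finally show ?thesis .
    qed
    ultimately show ?thesis using corner_gen(2)[OF i v'] by (simp add: tl_class_eq_iff[symmetric] mult.assoc)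
  qed
  show "corner_gen i (corner_gen k v) - corner_gen k (corner_gen i v) \<in> tl_ideal (N + 2) m" if ik: "i + 1 < k \<or> k + 1 < i"
  proof -
    have "gen i * gen k - gen k * gen i \<in> tl_ideal (N + 2) m"
      by (rule tl_relations_in_ideal[OF tl_relationsI(3)]) (use i k ik in auto)
    then have "cls (gen i * gen k) = cls (gen k * gen i)" by (simp add: tl_class_eq_iff)
    then have "cls (gen i * gen k * v) = cls (gen k * gen i * v)"
      using i k v' by (subst (1 2) cls_mult) simp_all
    then show ?thesis using word[OF i k] word[OF k i] by (simp add: tl_class_eq_iff[symmetric])
  qed
qed (use assms idem_idem linear_op_corner_gen in simp_all)

lemma corner_map_class: "corner_map N m (tl_class N m f) = cls (corner_lift f)"
proof -
  have gen_eq: "(\<lambda>i h. e * gen i * e * h) = corner_gen" by (simp add: fun_eq_iff corner_gen_def)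
  have "cls (extend_action corner_gen (h + f) e) = cls (extend_action corner_gen f e)" if "h \<in> tl_ideal N m" for h
    using corner_lift_ideal[OF that] by (simp add: tl_class_eq_iff extend_action_simps corner_lift_def)
  then show ?thesis
    unfolding corner_map_def corner_lift_def gen_eq by (rule the_elem_image_tl_class)
qed

lemma corner_lift_closed:
  assumes "f \<in> carrier (free_algebra N)"
  shows "corner_lift f \<in> A" "cls (corner_lift f * e) = cls (corner_lift f)"
proof -
  have "corner_lift f \<in> A \<and> cls (corner_lift f * e) = cls (corner_lift f)"
    using assms unfolding corner_lift_def
  proof (induction rule: free_algebra_induct)
    case (scalar c)
    then show ?case using cls_scale_cong[OF _ _ idem_idem, of c] by (simp add: scale_mult)
  next
    case (add f g)
    then show ?case by (simp add: extend_action_simps distrib_right TL_simps(2)[symmetric])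
  next
    case (gen i f)
    define y where "y = extend_action corner_gen f e"
    have "corner_gen i y * e = e * gen i * e * (y * e)" by (simp add: corner_gen_def mult.assoc)
    moreover have "cls (e * gen i * e * (y * e)) = cls (corner_gen i y)"
      unfolding corner_gen_def using gen by (intro cls_mult_cong) (simp_all add: y_def)
    ultimately show ?case
      using gen by (simp add: extend_action_mult[OF linear_op_corner_gen] y_def[symmetric]) (simp add: corner_gen_def)
  qed
  then show "corner_lift f \<in> A" "cls (corner_lift f * e) = cls (corner_lift f)" by auto
qed

lemma idem_corner_lift:
  assumes "f \<in> carrier (free_algebra N)"
  shows "cls (e * corner_lift f) = cls (corner_lift f)"
proof -
  have "corner_lift f \<in> A \<and> cls (e * corner_lift f) = cls (corner_lift f)"
    using assms unfolding corner_lift_def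
  proof (induction rule: free_algebra_induct)
    case (scalar c)
    then show ?case using cls_scale_cong[OF _ _ idem_idem, of c] by (simp add: mult_scale)
  next
    case (add f g)
    then show ?case by (simp add: extend_action_simps distrib_left TL_simps(2)[symmetric])
  next
    case (gen i f)
    then show ?case
      using corner_gen[of i "extend_action corner_gen f e"] by (simp add: extend_action_mult[OF linear_op_corner_gen])
  qed
  then show ?thesis ..
qed

abbreviation "P \<equiv> corner_module N m"

lemma corner_module_simps:
  "ring.zero P = \<zero>\<^bsub>T'\<^esub>" "ring.add P = ring.add T'" "smult P = monoid.mult T'"
  by (simp_all add: corner_module_def)

text \<open>
  The right multiples of an idempotent are the elements that it fixes.
\<close>

lemma carrier_corner: "carrier P = {x \<in> carrier T'. x \<otimes>\<^bsub>T'\<^esub> cls e = x}"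
proof -
  have e: "cls e \<in> carrier T'" "cls e \<otimes>\<^bsub>T'\<^esub> cls e = cls e" using idem_idem by (simp_all add: cls_mult)
  then have "a \<otimes>\<^bsub>T'\<^esub> cls e \<otimes>\<^bsub>T'\<^esub> cls e = a \<otimes>\<^bsub>T'\<^esub> cls e" if "a \<in> carrier T'" for a
    using that by (simp add: T'.m_assoc)
  with e show ?thesis by (auto simp: corner_module_def)
qed

lemma left_module_corner: "left_module T' P"
proof (intro left_module.intro left_module_axioms.intro ring_TL)
  have e: "cls e \<in> carrier T'" by simp
  show "abelian_group P"
  proof (rule abelian_groupI)
    fix x assume "x \<in> carrier P"
    then show "\<exists>y\<in>carrier P. y \<oplus>\<^bsub>P\<^esub> x = \<zero>\<^bsub>P\<^esub>"
      by (intro bexI[of _ "\<ominus>\<^bsub>T'\<^esub> x"]) (auto simp: carrier_corner corner_module_simps T'.l_minus T'.l_neg e)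
  qed (use e in \<open>auto simp: carrier_corner corner_module_simps T'.l_distr T'.a_ac\<close>)
qed (auto simp: carrier_corner corner_module_simps T'.l_distr T'.r_distr T'.m_assoc)

end

section \<open>Globalizing the standard module\<close>

locale globalized_standard_module = corner +
  fixes j :: real
  assumes j: "j \<le> real N / 2"
begin

abbreviation "W \<equiv> standard_module N m j"
abbreviation "W' \<equiv> standard_module (N + 2) m j"
abbreviation "ract x a \<equiv> x \<otimes>\<^bsub>T'\<^esub> corner_map N m a"

sublocale G: tensor_bimodule T' P "TL N m" ract W
proof (intro tensor_bimodule.intro tensor_bimodule_axioms.intro left_module_corner abelian_group_standard_module)
  have map: "corner_map N m r \<in> carrier T'" "corner_map N m r \<otimes>\<^bsub>T'\<^esub> cls e = corner_map N m r"
    if "r \<in> carrier (TL N m)" for r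
    using TL_cases[OF that] corner_lift_closed by (metis corner_map_class tl_class_closed cls_mult idem_closed)+
  show "ract x r \<in> carrier P" if "x \<in> carrier P" "r \<in> carrier (TL N m)" for x r
    using that map[OF that(2)] by (simp add: carrier_corner T'.m_assoc)
  show "a \<odot>\<^bsub>P\<^esub> ract x r = ract (a \<odot>\<^bsub>P\<^esub> x) r"
    if "a \<in> carrier T'" "x \<in> carrier P" "r \<in> carrier (TL N m)" for a x r
    using that map[OF that(3)] by (simp add: carrier_corner corner_module_simps T'.m_assoc)
  show "r \<odot>\<^bsub>W\<^esub> v \<in> carrier W" if "r \<in> carrier (TL N m)" "v \<in> carrier W" for r v
    by (rule left_module.smult_closed[OF left_module_standard_module that])
qed

lemma globalization_eq: "globalization N m W = G.T"
  by (simp add: globalization_def)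

sublocale GM: left_module T' G.T by (rule G.left_module_tensor)
sublocale W': left_module T' W' by (rule left_module_standard_module)

lemma idem_in_corner: "cls e \<in> carrier P"
  using idem_idem by (simp add: carrier_corner cls_mult[symmetric])

definition \<theta> :: "(link \<Rightarrow>\<^sub>0 complex) \<Rightarrow> (free_alg set \<times> (link \<Rightarrow>\<^sub>0 complex) \<Rightarrow>\<^sub>0 int) set" where
  "\<theta> w = G.tens (cls e) w"

text \<open>
  An element of the smaller algebra moves from the right tensor factor to the left one as \<open>corner_lift f\<close>;
  if the latter is \<open>g e\<close>, the factor \<open>g\<close> acts on the whole tensor.
\<close>

lemma \<theta>_balanced:
  assumes w: "w \<in> link_space N j" and f: "f \<in> carrier (free_algebra N)" and g: "g \<in> A"
    and eq: "cls (corner_lift f) = cls (g * e)"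
  shows "\<theta> (tl_action m f w) = cls g \<odot>\<^bsub>G.T\<^esub> \<theta> w"
proof -
  have W: "w \<in> carrier W" using w by (simp only: standard_module_simps)
  have lift: "corner_lift f \<in> A" by (rule corner_lift_closed[OF f])
  have e_lift: "cls e \<otimes>\<^bsub>T'\<^esub> cls (corner_lift f) = cls (corner_lift f)"
    using idem_corner_lift[OF f] lift by (simp add: cls_mult)
  have "\<theta> (tl_action m f w) = G.tens (cls e) (tl_class N m f \<odot>\<^bsub>W\<^esub> w)"
    unfolding \<theta>_def standard_module_smult[OF f w] ..
  also have "\<dots> = G.tens (ract (cls e) (tl_class N m f)) w"
    by (rule G.tens_balanced[OF idem_in_corner tl_class_closed[OF f] W, symmetric])
  also have "ract (cls e) (tl_class N m f) = cls g \<otimes>\<^bsub>T'\<^esub> cls e"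
    unfolding corner_map_class e_lift unfolding eq by (rule cls_mult[OF g idem_closed])
  also have "G.tens \<dots> w = cls g \<odot>\<^bsub>G.T\<^esub> \<theta> w"
    unfolding \<theta>_def G.smult_tens[OF tl_class_closed[OF g]] corner_module_simps ..
  finally show ?thesis .
qed

sublocale \<Phi>: arc_closing_map N m G.T j \<theta>
proof (intro arc_closing_map.intro arc_closing_map_axioms.intro G.left_module_tensor m j)
  fix w assume w: "w \<in> link_space N j"
  show "\<theta> w \<in> carrier G.T" using w idem_in_corner by (simp add: \<theta>_def standard_module_simps)
  show "\<theta> (v + w) = \<theta> v \<oplus>\<^bsub>G.T\<^esub> \<theta> w" if "v \<in> link_space N j" for v
    using G.tens_add_right[OF idem_in_corner, of v w] that w by (simp add: \<theta>_def standard_module_simps)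
  show "\<theta> (scale c w) = cls (scalar c) \<odot>\<^bsub>G.T\<^esub> \<theta> w" for c
    using \<theta>_balanced[OF w, of "scalar c" "scalar c"] by (simp add: corner_lift_def)
  show "\<theta> (gen_action m i w) = cls (gen i) \<odot>\<^bsub>G.T\<^esub> \<theta> w" if "1 \<le> i" "i < N" for i
    using \<theta>_balanced[OF w, of "gen i" "gen i"] corner_gen(2)[OF that, of e] that idem_idem
    by (simp add: corner_lift_def)
  show "\<theta> (scale m w) = cls (gen (N + 1)) \<odot>\<^bsub>G.T\<^esub> \<theta> w"
    using \<theta>_balanced[OF w, of "scalar m" "gen (N + 1)"] gen_idem by (simp add: corner_lift_def)
qed

text \<open>
  Joining the two new points by an arc is the map that \<open>\<theta>\<close> imitates; the idempotent fixes its image.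
\<close>

abbreviation cap :: "(link \<Rightarrow>\<^sub>0 complex) \<Rightarrow> link \<Rightarrow>\<^sub>0 complex" where
  "cap \<equiv> insert_arcs (N + 1)"

lemma cap_closed: "w \<in> link_space N j \<Longrightarrow> cap w \<in> link_space (N + 2) j"
  by (rule insert_arcs_closed) simp_all

lemma idem_cap: "tl_action m e (cap w) = cap w"
  using m by (simp add: idem_eq extend_action_simps gen_action_insert_arcs_same[of m "N + 1", simplified])

text \<open>
  This says that \<open>(x, w) \<mapsto> x \<cdot> cap w\<close> is balanced, so that it induces a map on the globalization.
\<close>

lemma corner_lift_cap:
  assumes "f \<in> carrier (free_algebra N)"
  shows "tl_action m (corner_lift f) (cap w) = cap (tl_action m f w)"
  using assms unfolding corner_lift_def
proof (induction rule: free_algebra_induct)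
  case (scalar c)
  then show ?case by (simp add: extend_action_simps idem_cap[simplified] lin_simps)
next
  case (add f g)
  then show ?case by (simp add: extend_action_simps lin_simps)
next
  case (gen i f)
  note mult = extend_action_mult[OF linear_op_gen_action]
  have "gen_action m i (cap u) = cap (gen_action m i u)" for u
    using gen_action_insert_arcs_far[of i "N + 1" m u] gen by (simp add: skip_def)
  moreover have "extend_action corner_gen (gen i * f) e = e * gen i * e * extend_action corner_gen f e"
    unfolding extend_action_mult[OF linear_op_corner_gen] extend_action_gen by (rule corner_gen_def)
  ultimately show ?case using gen(4) by (simp add: mult idem_cap[simplified])
qed

text \<open>
  The map \<open>h\<close> induced by \<open>(x, w) \<mapsto> x \<cdot> cap w\<close> and the extension \<open>\<Phi>\<close> of \<open>w \<mapsto> e \<otimes> w\<close> are inverse to each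
  other: \<open>\<Phi> \<circ> h\<close> fixes every \<open>x \<cdot> (e \<otimes> w) = x \<otimes> w\<close>, and \<open>h \<circ> \<Phi>\<close> fixes \<open>insert_arcs k w\<close> because
  \<open>e\<^sub>k \<dots> e\<^sub>N\<close> carries \<open>cap w\<close> there.
\<close>

lemma globalization_iso: "left_module_iso T' G.T W'"
proof -
  note smult = standard_module_smult[where N = "N + 2" and m = m and j = j]
  have capW: "cap w \<in> carrier W'" if "w \<in> carrier W" for w
    using cap_closed that by (simp only: standard_module_simps)
  have P_T: "x \<in> carrier T'" if "x \<in> carrier P" for x using that by (simp add: carrier_corner)
  obtain h where h_closed: "\<And>g. g \<in> carrier G.T \<Longrightarrow> h g \<in> carrier W'"
    and h_add: "\<And>g g'. g \<in> carrier G.T \<Longrightarrow> g' \<in> carrier G.T \<Longrightarrow> h (g \<oplus>\<^bsub>G.T\<^esub> g') = h g \<oplus>\<^bsub>W'\<^esub> h g'"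
    and h_tens: "\<And>x w. x \<in> carrier P \<Longrightarrow> w \<in> carrier W \<Longrightarrow> h (G.tens x w) = x \<odot>\<^bsub>W'\<^esub> cap w"
  proof (rule G.tensor_universal[where A = W' and b = "\<lambda>x w. x \<odot>\<^bsub>W'\<^esub> cap w"])
    show "abelian_group W'" by (rule abelian_group_standard_module)
    fix x w assume x: "x \<in> carrier P" and w: "w \<in> carrier W"
    show "x \<odot>\<^bsub>W'\<^esub> cap w \<in> carrier W'" using W'.smult_closed P_T x capW w by blast
    show "(x \<oplus>\<^bsub>P\<^esub> y) \<odot>\<^bsub>W'\<^esub> cap w = x \<odot>\<^bsub>W'\<^esub> cap w \<oplus>\<^bsub>W'\<^esub> y \<odot>\<^bsub>W'\<^esub> cap w" if "y \<in> carrier P" for y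
      using W'.smult_l_distr[OF P_T P_T capW] x w that by (simp only: corner_module_simps)
    show "x \<odot>\<^bsub>W'\<^esub> cap (w \<oplus>\<^bsub>W\<^esub> w') = x \<odot>\<^bsub>W'\<^esub> cap w \<oplus>\<^bsub>W'\<^esub> x \<odot>\<^bsub>W'\<^esub> cap w'" if "w' \<in> carrier W" for w'
      using W'.smult_r_distr[OF P_T[OF x] capW[OF w] capW[OF that]] by (simp only: standard_module_simps lin_simps)
    fix r assume "r \<in> carrier (TL N m)"
    then obtain f where f: "f \<in> carrier (free_algebra N)" "r = tl_class N m f" by (rule TL_cases)
    have w': "w \<in> link_space N j" using w by (simp only: standard_module_simps)
    have "corner_map N m r \<odot>\<^bsub>W'\<^esub> cap w = cap (r \<odot>\<^bsub>W\<^esub> w)"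
      unfolding f(2) corner_map_class standard_module_smult[OF f(1) w']
        smult[OF corner_lift_closed(1)[OF f(1)] cap_closed[OF w']] by (rule corner_lift_cap[OF f(1)])
    moreover have "ract x r \<odot>\<^bsub>W'\<^esub> cap w = x \<odot>\<^bsub>W'\<^esub> (corner_map N m r \<odot>\<^bsub>W'\<^esub> cap w)"
      using corner_lift_closed(1)[OF f(1)]
      by (intro W'.smult_assoc[OF P_T[OF x] _ capW[OF w]]) (simp add: f(2) corner_map_class)
    ultimately show "ract x r \<odot>\<^bsub>W'\<^esub> cap w = x \<odot>\<^bsub>W'\<^esub> cap (r \<odot>\<^bsub>W\<^esub> w)" by simp
  qed blast
  have h_smult: "h (a \<odot>\<^bsub>G.T\<^esub> g) = a \<odot>\<^bsub>W'\<^esub> h g" if a: "a \<in> carrier T'" and "g \<in> carrier G.T" for a g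
    using that(2)
  proof (induction rule: G.tensor_induct)
    case (tens x w)
    have ax: "a \<otimes>\<^bsub>T'\<^esub> x \<in> carrier P" using left_module.smult_closed[OF left_module_corner a tens(1)] by (simp only: corner_module_simps)
    show ?case
      unfolding G.smult_tens[OF a] corner_module_simps h_tens[OF ax tens(2)] h_tens[OF tens]
      by (rule W'.smult_assoc[OF a P_T[OF tens(1)] capW[OF tens(2)]])
  next
    case (add g g')
    then show ?case
      by (simp only: GM.smult_r_distr[OF a] h_add GM.smult_closed[OF a] W'.smult_r_distr[OF a] h_closed)
  qed
  have h_\<theta>: "h (\<theta> w) = cap w" if "w \<in> link_space N j" for w
    using h_tens[OF idem_in_corner, of w] smult[OF idem_closed cap_closed[OF that]] that
    unfolding \<theta>_def standard_module_simps by (simp only: idem_cap)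
  have \<Phi>_h: "\<Phi>.\<Phi> (h g) = g" if "g \<in> carrier G.T" for g
    using that
  proof (induction rule: G.tensor_induct)
    case (tens x w)
    have w: "w \<in> link_space N j" using tens(2) by (simp only: standard_module_simps)
    have x: "x \<in> carrier T'" "x \<otimes>\<^bsub>T'\<^esub> cls e = x" using tens(1) by (simp_all add: carrier_corner)
    have "\<Phi>.\<Phi> (h (G.tens x w)) = x \<odot>\<^bsub>G.T\<^esub> \<Phi>.\<Phi> (cap w)"
      unfolding h_tens[OF tens] by (rule \<Phi>.\<Phi>_linear[OF x(1) cap_closed[OF w]])
    also have "\<Phi>.\<Phi> (cap w) = \<theta> w"
      using \<Phi>.\<Phi>_insert_arcs[OF w, of "N + 1"] \<Phi>.\<phi>_last by simp
    also have "x \<odot>\<^bsub>G.T\<^esub> \<theta> w = G.tens x w"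
      unfolding \<theta>_def G.smult_tens[OF x(1)] corner_module_simps x(2) ..
    finally show ?case .
  next
    case (add g g')
    then show ?case by (simp only: h_add standard_module_simps \<Phi>.\<Phi>_add)
  qed
  have h_\<phi>: "h (\<Phi>.\<phi> k w) = insert_arcs k w" if "1 \<le> k" "k \<le> N + 1" and w: "w \<in> link_space N j" for k w
    using that(1,2)
  proof (induction rule: \<Phi>.position_induct)
    case last
    show ?case unfolding \<Phi>.\<phi>_last by (rule h_\<theta>[OF w])
  next
    case (step k)
    have ins: "insert_arcs (k + 1) w \<in> link_space (N + 2) j" using insert_arcs_closed[OF w, of "k + 1"] step by simp
    have "h (\<Phi>.\<phi> k w) = cls (gen k) \<odot>\<^bsub>W'\<^esub> h (\<Phi>.\<phi> (k + 1) w)"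
      unfolding \<Phi>.\<phi>_step[OF step(2)] \<Phi>.act_def
      by (rule h_smult) (use step \<Phi>.\<phi>_closed[OF _ _ w, of "k + 1"] in simp_all)
    also have "\<dots> = gen_action m k (insert_arcs (k + 1) w)"
      unfolding step(3) using smult[OF _ ins, of "gen k"] step by simp
    also have "\<dots> = insert_arcs k w" by (rule gen_action_insert_arcs_left[OF w])
    finally show ?case .
  qed
  have h_\<Phi>: "h (\<Phi>.\<Phi> v) = v" if "v \<in> carrier W'" for v
  proof -
    have "Poly_Mapping.keys v \<subseteq> link_states (N + 2) j" using that by (simp add: standard_module_simps)
    then show ?thesis
    proof (induction rule: poly_mapping_span_induct)
      case zero
      have "h \<zero>\<^bsub>G.T\<^esub> = h \<zero>\<^bsub>G.T\<^esub> + h \<zero>\<^bsub>G.T\<^esub>"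
        using h_add[of "\<zero>\<^bsub>G.T\<^esub>" "\<zero>\<^bsub>G.T\<^esub>"] by (simp add: standard_module_simps)
      then show ?case by (simp add: \<Phi>.\<Phi>_zero)
    next
      case (single Q c)
      then obtain k p where k: "1 \<le> k" "k \<le> N + 1" and p: "p \<in> link_states N j" and Q: "Q = insert_arc k p"
        by (rule \<Phi>.link_state_has_arc)
      have w: "Poly_Mapping.single p c \<in> link_space N j" using p by simp
      have "Poly_Mapping.single Q c = insert_arcs k (Poly_Mapping.single p c)" by (simp add: Q)
      then show ?case using h_\<phi>[OF k w] \<Phi>.\<Phi>_insert_arcs[OF w k] by simp
    next
      case (add v w)
      then show ?case by (simp only: \<Phi>.\<Phi>_add h_add \<Phi>.\<Phi>_closed standard_module_simps)
    qed
  qed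
  have "bij_betw h (carrier G.T) (carrier W')"
    by (rule bij_betw_byWitness[where f' = \<Phi>.\<Phi>]) (use \<Phi>_h h_\<Phi> h_closed \<Phi>.\<Phi>_closed in auto)
  then show ?thesis
    unfolding left_module_iso_def
    using G.left_module_tensor left_module_standard_module h_add h_smult by blast
qed

end

theorem proposition5p3p3:
  fixes q m :: complex and N :: nat and x j :: real
  assumes "q \<noteq> 0" and "m = q + inverse q" and "m \<noteq> 0"
    and "N \<ge> 1"
    and "x = 1 / 2 * real (N mod 2)"
    and "j - x \<in> \<int>" and "x \<le> j" and "j \<le> real N / 2"
  shows "left_module_iso (TL (N + 2) m)
           (globalization N m (standard_module N m j)) (standard_module (N + 2) m j)"
proof -
  interpret globalized_standard_module N m j
    by unfold_locales (use assms in auto)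
  show ?thesis unfolding globalization_eq by (rule globalization_iso)
qed

end
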